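(* Let $h(x)=\chi(f_*|_{W(G,f)})$. Then $$V(G)\cong W(G,f)\oplus \operatorname{im}\delta,\qquad \chi(f_* )=h(x)\,\chi(f_*|_{\operatorname{im}\delta}).$$ The degree of $h(x)$ is $\dim W(G,f)$, which equals $\#(\text{edges of }G)-\#(\text{vertices of }G)+1$ if $\tau$ is orientable and $\#(\text{edges of }G)-\#(\text{non-odd vertices of }G)$ if $\tau$ is non-orientable. The degree of $\chi(f_*|_{\operatorname{im}\delta})$ is $\dim(\operatorname{im}\delta)$, which equals $m-1$ if $\tau$ is orientable and $m$ if $\tau$ is non-orientable, where $m$ is the number of non-odd vertices of $G$.
   Context: Setting. $S$ is an orientable surface of finite genus with finitely many (at least one) punctures, admitting a hyperbolic structure; $[F]\in\mathrm{Mod}(S)=\pi_0(\mathrm{Diff}(S))$ is pseudo-Anosov. The Bestvina--Handel algorithm applied to $[F]$ yields a finite graph $G\subset S$, whose inclusion is a homotopy equivalence, and a train track map $f:G\to G$ induced by $F$: $f$ sends vertices to vertices and edges to edge-paths without backtracking, and for all $r\ge 1$ the map $f^r$ is an immersion on the interior of every edge. Let $e_1,\dots,e_n$ be the unoriented edges of $G$; the transition matrix $T$ has entries $T_{i,j}$ = number of times $f(e_j)$ passes over $e_i$ in either direction. $V(G)\cong\mathbb R^n$ is the space of real weights on the edges, and $f_*:V(G)\to V(G)$ is the linear map with matrix $T$. For a linear endomorphism $\varphi$, $\chi(\varphi)=\det(xI-\varphi)$. Train track $\tau$. Two edge-ends at a vertex $v$ belong to the same gate if for some $r>0$ their images under $f^r$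 (read starting from $v$) have a nontrivial common initial segment. $\tau\subset S$ is obtained from $G$ by turning each gate into a switch, at which the edges of $G$ in that gate (the real edges) are tangent on one side, and by joining the gates of two edge-ends $e_1,e_2$ at $v$ in different gates by an infinitesimal edge (attached at the other side of the switches) whenever, for some $r>0$ and some edge $e$, $f^r(e)$ contains $e_1e_2$ or $e_2e_1$. By Bestvina--Handel, the infinitesimal edges at a vertex with $k$ gates form a $k$-gon, possibly with one side missing. A vertex is odd (even) if this is a complete polygon with an odd (even) number of sides, and partial if one side is missing (including vertices with two gates joined by one infinitesimal edge); non-odd means even or partial. Gates at $v$ are numbered $0,\dots,k-1$ in cyclic order, at a partial vertex so that the missing side is between gates $k-1$ and $0$. $\tau$ is orientable if its branches (real and infinitesimal edges) can be oriented so that at every switch all branches on one side are incoming and all on the other side outgoing. $W(G,f)$. $W(\tau)$ is the space of real (possibly negative) weights on the branches of $\tau$ satisfying the switch conditions (at each switch the sum of weights on one side equals the sum on the other). $\pi:\tau\to G$ collapses the infinitesimal (partial) polygons to vertices, and $W(G,f)=\pi_*(W(\tau))\subset V(G)$. The map $\delta$. The weight $w_i^v(\eta)$ of $\eta\in V(G)$ at gate $i$ of $v$ is the sum of $\eta$ over the edge-ends in that gate. If $v_1,\dots,v_m$ are the non-odd vertices, $\delta:V(G)\to\mathbb R^m$ is the linear map whose $k$-th entry is the alternating sum $\sum_i(-1)^iw_i^{v_k}(\eta)$; if $\tau$ is oriented, the sign of a gate is $+$ if the real edges there are oriented toward the vertex and $-$ otherwise; if $\tau$ is non-orientable, alternating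 signs are chosen locally at each non-odd vertex. One has $\ker\delta=W(G,f)$, and $f_*(W(G,f))\subseteq W(G,f)$; $f_*|_{\operatorname{im}\delta}$ denotes the map induced by $f_*$ on $V(G)/W(G,f)\cong\operatorname{im}\delta$. *)

theory Defs
  imports
    "HOL-Complex_Analysis.Complex_Analysis"
    "Jordan_Normal_Form.Char_Poly"
begin

section \<open>Smooth punctured surfaces\<close>

primrec Ck_on :: "nat \<Rightarrow> complex set \<Rightarrow> (complex \<Rightarrow> complex) \<Rightarrow> bool" where
  "Ck_on 0 W f \<longleftrightarrow> continuous_on W f"
| "Ck_on (Suc k) W f \<longleftrightarrow>
     (\<exists>fx fy. Ck_on k W fx \<and> Ck_on k W fy \<and>
       (\<forall>z\<in>W. (f has_derivative (\<lambda>h. Re h *\<^sub>R fx z + Im h *\<^sub>R fy z)) (at z)))"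

text \<open>Smoothness is real smoothness: the complex numbers serve as the plane.\<close>

definition smooth_on :: "complex set \<Rightarrow> (complex \<Rightarrow> complex) \<Rightarrow> bool" where
  "smooth_on W f \<longleftrightarrow> (\<forall>k. Ck_on k W f)"

definition jacobian :: "(complex \<Rightarrow> complex) \<Rightarrow> complex \<Rightarrow> real" where
  "jacobian f z = (let D = frechet_derivative f (at z) in Im (cnj (D 1) * D \<i>))"

definition chart :: "'s topology \<Rightarrow> 's set \<Rightarrow> ('s \<Rightarrow> complex) \<Rightarrow> bool" where
  "chart X U c \<longleftrightarrow> openin X U \<and> open (c ` U) \<and>
     homeomorphic_map (subtopology X U) (top_of_set (c ` U)) c"

definition closed_surface :: "'s topology \<Rightarrow> bool" where
  "closed_surface X \<longleftrightarrow> compact_space X \<and> connected_space X \<and> Hausdorff_space X \<and>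
     (\<forall>x\<in>topspace X. \<exists>U c. x \<in> U \<and> chart X U c)"

definition punctured :: "'s topology \<Rightarrow> 's set \<Rightarrow> 's topology" where
  "punctured X P = subtopology X (topspace X - P)"

definition oriented_smooth_atlas ::
    "'s topology \<Rightarrow> ('s set \<times> ('s \<Rightarrow> complex)) set \<Rightarrow> bool" where
  "oriented_smooth_atlas S A \<longleftrightarrow>
     (\<forall>(U, c)\<in>A. chart S U c) \<and> \<Union> (fst ` A) = topspace S \<and>
     (\<forall>(U, c)\<in>A. \<forall>(V, d)\<in>A.
        smooth_on (c ` (U \<inter> V)) (d \<circ> inv_into U c) \<and>
        (\<forall>z\<in>c ` (U \<inter> V). jacobian (d \<circ> inv_into U c) z > 0))"

definition smooth_map :: "('s set \<times> ('s \<Rightarrow> complex)) set \<Rightarrow> ('s \<Rightarrow> 's) \<Rightarrow> bool" where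
  "smooth_map A F \<longleftrightarrow>
     (\<forall>(U, c)\<in>A. \<forall>(V, d)\<in>A. smooth_on (c ` {x\<in>U. F x \<in> V}) (d \<circ> F \<circ> inv_into U c))"

definition diffeomorphism ::
    "'s topology \<Rightarrow> ('s set \<times> ('s \<Rightarrow> complex)) set \<Rightarrow> ('s \<Rightarrow> 's) \<Rightarrow> bool" where
  "diffeomorphism S A F \<longleftrightarrow>
     (\<exists>F'. homeomorphic_maps S S F F' \<and> smooth_map A F \<and> smooth_map A F')"

text \<open>
  A (complete) hyperbolic structure presents the surface as the quotient of the Poincare disc by
  a group of isometries acting freely and properly discontinuously. Here \<open>p\<close> is the covering
  projection; the group is that of all \<open>Moebius_function t w\<close> preserving \<open>p\<close>, which has to act
  transitively on the fibres.
\<close>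

definition admits_hyperbolic_structure ::
    "'s topology \<Rightarrow> ('s set \<times> ('s \<Rightarrow> complex)) set \<Rightarrow> bool" where
  "admits_hyperbolic_structure S A \<longleftrightarrow>
     (\<exists>p. quotient_map (top_of_set (ball 0 1)) S p \<and>
        (\<forall>z\<in>ball 0 1. \<exists>N. open N \<and> z \<in> N \<and> N \<subseteq> ball 0 1 \<and> inj_on p N) \<and>
        (\<forall>z\<in>ball 0 1. \<forall>z'\<in>ball 0 1. p z = p z' \<longrightarrow>
           (\<exists>t w. cmod w < 1 \<and> z' = Moebius_function t w z \<and>
                  (\<forall>u\<in>ball 0 1. p (Moebius_function t w u) = p u))) \<and>
        (\<forall>(U, c)\<in>A. smooth_on {z\<in>ball 0 1. p z \<in> U} (c \<circ> p) \<and>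
           (\<forall>z\<in>ball 0 1. p z \<in> U \<longrightarrow> jacobian (c \<circ> p) z \<noteq> 0)))"

definition isotopic :: "'s topology \<Rightarrow> ('s \<Rightarrow> 's) \<Rightarrow> ('s \<Rightarrow> 's) \<Rightarrow> bool" where
  "isotopic S F F' \<longleftrightarrow> homotopic_with (homeomorphic_map S S) S S F F'"

section \<open>Pseudo-Anosov classes\<close>

text \<open>
  A transverse pair of singular measured foliations is given by its atlas \<open>B\<close> of natural charts:
  in such a chart \<open>c\<close>, the transverse measures are \<open>\<bar>d (Re c)\<bar>\<close> and \<open>\<bar>d (Im c)\<bar>\<close>, the leaves
  being vertical and horizontal segments. As the surface is orientable, natural charts can be
  chosen with transition maps \<open>w \<mapsto> \<plusminus>w + a\<close>. At a singularity with \<open>k\<close> prongs the model is given by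
  the local branches of \<open>w = z powr (k / 2)\<close>; \<open>k \<ge> 3\<close> at a singularity in the surface,
  \<open>k \<ge> 1\<close> at a puncture.
\<close>

definition transverse_measured_foliations ::
    "'s topology \<Rightarrow> 's set \<Rightarrow> 's set \<Rightarrow> ('s set \<times> ('s \<Rightarrow> complex)) set \<Rightarrow> bool" where
  "transverse_measured_foliations X P Z B \<longleftrightarrow>
     finite Z \<and> Z \<subseteq> topspace X - P \<and>
     (\<forall>(U, c)\<in>B. chart X U c) \<and> \<Union> (fst ` B) = topspace X - P - Z \<and>
     (\<forall>(U, c)\<in>B. \<forall>(V, d)\<in>B. \<forall>x\<in>U \<inter> V.
        \<exists>N \<epsilon> a. openin X N \<and> x \<in> N \<and> \<epsilon> \<in> {1, -1} \<and>
          (\<forall>y\<in>N \<inter> U \<inter> V. d y = \<epsilon> * c y + a)) \<and>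
     (\<forall>z\<in>Z \<union> P. \<exists>k U c. (if z \<in> P then 1 else 3) \<le> (k::nat) \<and>
        chart X U c \<and> U \<inter> (Z \<union> P) = {z} \<and> c z = 0 \<and>
        (\<forall>(V, d)\<in>B. \<forall>x\<in>U \<inter> V.
           \<exists>N a. openin X N \<and> x \<in> N \<and> (\<forall>y\<in>N \<inter> U \<inter> V. (d y + a)^2 = c y ^ k)))"

definition pseudo_Anosov_homeomorphism ::
    "'s topology \<Rightarrow> 's set \<Rightarrow> ('s \<Rightarrow> 's) \<Rightarrow> bool" where
  "pseudo_Anosov_homeomorphism X P \<phi> \<longleftrightarrow>
     homeomorphic_map (punctured X P) (punctured X P) \<phi> \<and>
     (\<exists>Z B K. transverse_measured_foliations X P Z B \<and> \<phi> ` Z = Z \<and> (K::real) > 1 \<and>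
        (\<forall>(U, c)\<in>B. \<forall>(V, d)\<in>B. \<forall>x\<in>U. \<phi> x \<in> V \<longrightarrow>
           (\<exists>N \<epsilon> \<epsilon>' a. openin X N \<and> x \<in> N \<and> \<epsilon> \<in> {1, -1} \<and> \<epsilon>' \<in> {1, -1} \<and>
             (\<forall>y\<in>N \<inter> U. \<phi> y \<in> V \<longrightarrow>
                d (\<phi> y) = Complex (\<epsilon> * K * Re (c y)) (\<epsilon>' / K * Im (c y)) + a))))"

definition pseudo_Anosov :: "'s topology \<Rightarrow> 's set \<Rightarrow> ('s \<Rightarrow> 's) \<Rightarrow> bool" where
  "pseudo_Anosov X P F \<longleftrightarrow>
     (\<exists>\<phi>. pseudo_Anosov_homeomorphism X P \<phi> \<and> isotopic (punctured X P) F \<phi>)"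

section \<open>Embedded graphs and train track maps\<close>

text \<open>
  Vertices and unoriented edges are the elements of the finite types \<open>'v\<close> and \<open>'e\<close>. A dart
  \<open>(e, b)\<close> is the edge \<open>e\<close> traversed forwards (\<open>b = True\<close>) or backwards; it also stands for the
  edge-end at which this traversal starts, so that a loop contributes two edge-ends to its vertex.
\<close>

type_synonym 'e dart = "'e \<times> bool"
type_synonym 'e gate = "'e dart set"

record ('s, 'v, 'e) graph_map =
  pos :: "'v \<Rightarrow> 's"
  arc :: "'e \<Rightarrow> real \<Rightarrow> 's"
  base :: "'e dart \<Rightarrow> 'v"
  vmap :: "'v \<Rightarrow> 'v"
  emap :: "'e \<Rightarrow> 'e dart list"

text \<open>
  The last two fields are the graph map: the images of vertices, and for each forward dart the
  edge-path it is sent to.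
\<close>

fun flip :: "'e dart \<Rightarrow> 'e dart" where
  "flip (e, b) = (e, \<not> b)"

fun dart_arc :: "('s, 'v, 'e) graph_map \<Rightarrow> 'e dart \<Rightarrow> real \<Rightarrow> 's" where
  "dart_arc G (e, b) t = (if b then arc G e t else arc G e (1 - t))"

definition embedded_graph :: "'s topology \<Rightarrow> ('s, 'v, 'e) graph_map \<Rightarrow> bool" where
  "embedded_graph S G \<longleftrightarrow>
     inj (pos G) \<and> range (pos G) \<subseteq> topspace S \<and>
     (\<forall>e. pathin S (arc G e) \<and>
          arc G e 0 = pos G (base G (e, True)) \<and> arc G e 1 = pos G (base G (e, False)) \<and>
          inj_on (arc G e) {0<..<1} \<and> arc G e ` {0<..<1} \<inter> range (pos G) = {}) \<and>
     (\<forall>e e'. e \<noteq> e' \<longrightarrow> arc G e ` {0<..<1} \<inter> arc G e' ` {0<..<1} = {})"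

definition graph_space :: "'s topology \<Rightarrow> ('s, 'v, 'e) graph_map \<Rightarrow> 's topology" where
  "graph_space S G = subtopology S (range (pos G) \<union> (\<Union>e. arc G e ` {0..1}))"

definition inclusion_homotopy_equivalence ::
    "'s topology \<Rightarrow> ('s, 'v, 'e) graph_map \<Rightarrow> bool" where
  "inclusion_homotopy_equivalence S G \<longleftrightarrow>
     (\<exists>r. continuous_map S (graph_space S G) r \<and>
        homotopic_with (\<lambda>_. True) (graph_space S G) (graph_space S G) r id \<and>
        homotopic_with (\<lambda>_. True) S S r id)"

fun dart_image :: "('s, 'v, 'e) graph_map \<Rightarrow> 'e dart \<Rightarrow> 'e dart list" where
  "dart_image G (e, b) = (if b then emap G e else rev (map flip (emap G e)))"

definition path_image_map :: "('s, 'v, 'e) graph_map \<Rightarrow> 'e dart list \<Rightarrow> 'e dart list" where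
  "path_image_map G p = concat (map (dart_image G) p)"

text \<open>The edge-path \<open>f\<^sup>r(d)\<close> without tightening.\<close>

definition iterate :: "('s, 'v, 'e) graph_map \<Rightarrow> nat \<Rightarrow> 'e dart \<Rightarrow> 'e dart list" where
  "iterate G r d = (path_image_map G ^^ r) [d]"

definition no_backtracking :: "'e dart list \<Rightarrow> bool" where
  "no_backtracking p \<longleftrightarrow> successively (\<lambda>d d'. d' \<noteq> flip d) p"

text \<open>
  The map \<open>f\<^sup>r\<close> traverses the edge-path of an edge monotonically along each of its darts, so it is
  an immersion on the interior of the edge iff this path has no backtracking.
\<close>

definition train_track_map :: "('s, 'v, 'e) graph_map \<Rightarrow> bool" where
  "train_track_map G \<longleftrightarrow>
     (\<forall>e. emap G e \<noteq> [] \<and>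
          successively (\<lambda>d d'. base G d' = base G (flip d)) (emap G e) \<and>
          base G (hd (emap G e)) = vmap G (base G (e, True)) \<and>
          base G (flip (last (emap G e))) = vmap G (base G (e, False))) \<and>
     (\<forall>r\<ge>1. \<forall>e. no_backtracking (iterate G r (e, True)))"

text \<open>
  The combinatorial map is realised by the continuous map running through each edge-path with
  constant speed; this realisation has to be homotopic, in the surface, to the restriction of \<open>F\<close>.
\<close>

definition induced_by :: "'s topology \<Rightarrow> ('s, 'v, 'e) graph_map \<Rightarrow> ('s \<Rightarrow> 's) \<Rightarrow> bool" where
  "induced_by S G F \<longleftrightarrow>
     (\<exists>f. continuous_map (graph_space S G) (graph_space S G) f \<and>
        (\<forall>v. f (pos G v) = pos G (vmap G v)) \<and>
        (\<forall>e i t. i < length (emap G e) \<and> t \<in> {0..1} \<longrightarrow>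
           f (arc G e ((real i + t) / real (length (emap G e)))) = dart_arc G (emap G e ! i) t) \<and>
        homotopic_with (\<lambda>_. True) (graph_space S G) S f F)"

definition transition_matrix :: "('s, 'v, 'e::finite) graph_map \<Rightarrow> real^'e^'e" where
  "transition_matrix G = vec_lambda (\<lambda>i. vec_lambda (\<lambda>j. real (count_list (map fst (emap G j)) i)))"

definition fstar :: "('s, 'v, 'e::finite) graph_map \<Rightarrow> real^'e \<Rightarrow> real^'e" where
  "fstar G \<eta> = transition_matrix G *v \<eta>"

section \<open>Gates and the train track\<close>

definition same_gate :: "('s, 'v, 'e) graph_map \<Rightarrow> 'e dart \<Rightarrow> 'e dart \<Rightarrow> bool" where
  "same_gate G d d' \<longleftrightarrow> base G d = base G d' \<and>
     (\<exists>r>0. hd (iterate G r d) = hd (iterate G r d'))"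

definition gates_at :: "('s, 'v, 'e) graph_map \<Rightarrow> 'v \<Rightarrow> 'e gate set" where
  "gates_at G v = {{d'. same_gate G d d'} |d. base G d = v}"

definition takes_turn :: "'e dart list \<Rightarrow> 'e dart \<Rightarrow> 'e dart \<Rightarrow> bool" where
  "takes_turn p d d' \<longleftrightarrow> (\<exists>q q'. p = q @ [flip d, d'] @ q')"

text \<open>An infinitesimal edge is represented by the pair of gates it joins.\<close>

definition infinitesimal_edges :: "('s, 'v, 'e) graph_map \<Rightarrow> 'v \<Rightarrow> 'e gate set set" where
  "infinitesimal_edges G v =
     {{a, b} |a b. a \<in> gates_at G v \<and> b \<in> gates_at G v \<and> a \<noteq> b \<and>
        (\<exists>r>0. \<exists>e. \<exists>d\<in>a. \<exists>d'\<in>b. takes_turn (iterate G r (e, True)) d d')}"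

text \<open>
  The cyclic order of the edge-ends at a vertex is read off in a chart in which the initial
  segments of the edge-ends are the radii of the unit disc, at the angles \<open>\<theta>\<close>.
\<close>

definition edge_end_angles ::
    "'s topology \<Rightarrow> ('s, 'v, 'e) graph_map \<Rightarrow> 'v \<Rightarrow> ('e dart \<Rightarrow> real) \<Rightarrow> bool" where
  "edge_end_angles S G v \<theta> \<longleftrightarrow>
     inj_on \<theta> {d. base G d = v} \<and>
     (\<exists>a. \<forall>d. base G d = v \<longrightarrow> a \<le> \<theta> d \<and> \<theta> d < a + 2 * pi) \<and>
     (\<exists>U c. chart S U c \<and> pos G v \<in> U \<and> c (pos G v) = 0 \<and> c ` U = ball 0 1 \<and>
        (\<forall>d. base G d = v \<longrightarrow>
           (\<exists>\<epsilon>. 0 < \<epsilon> \<and> \<epsilon> < 1 \<and> dart_arc G d ` {0..<\<epsilon>} \<subseteq> U \<and>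
             c ` dart_arc G d ` {0..<\<epsilon>} = {of_real t * cis (\<theta> d) |t. 0 \<le> t \<and> t < 1})))"

definition cyclic_numbering ::
    "'s topology \<Rightarrow> ('s, 'v, 'e) graph_map \<Rightarrow> 'v \<Rightarrow> (nat \<Rightarrow> 'e gate) \<Rightarrow> bool" where
  "cyclic_numbering S G v g \<longleftrightarrow>
     bij_betw g {..<card (gates_at G v)} (gates_at G v) \<and>
     (\<exists>\<theta>. edge_end_angles S G v \<theta> \<and>
        (\<forall>i j d d'. i < j \<and> j < card (gates_at G v) \<and> d \<in> g i \<and> d' \<in> g j \<longrightarrow> \<theta> d < \<theta> d'))"

text \<open>There is no complete polygon with two sides: a single edge joining two gates is partial.\<close>

definition complete_numbering ::
    "'s topology \<Rightarrow> ('s, 'v, 'e) graph_map \<Rightarrow> 'v \<Rightarrow> (nat \<Rightarrow> 'e gate) \<Rightarrow> bool" where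
  "complete_numbering S G v g \<longleftrightarrow> cyclic_numbering S G v g \<and> 3 \<le> card (gates_at G v) \<and>
     infinitesimal_edges G v =
       {{g i, g (Suc i mod card (gates_at G v))} |i. i < card (gates_at G v)}"

definition partial_numbering ::
    "'s topology \<Rightarrow> ('s, 'v, 'e) graph_map \<Rightarrow> 'v \<Rightarrow> (nat \<Rightarrow> 'e gate) \<Rightarrow> bool" where
  "partial_numbering S G v g \<longleftrightarrow> cyclic_numbering S G v g \<and>
     infinitesimal_edges G v = {{g i, g (Suc i)} |i. Suc i < card (gates_at G v)}"

definition odd_vertex :: "'s topology \<Rightarrow> ('s, 'v, 'e) graph_map \<Rightarrow> 'v \<Rightarrow> bool" where
  "odd_vertex S G v \<longleftrightarrow> (\<exists>g. complete_numbering S G v g) \<and> odd (card (gates_at G v))"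

definition even_vertex :: "'s topology \<Rightarrow> ('s, 'v, 'e) graph_map \<Rightarrow> 'v \<Rightarrow> bool" where
  "even_vertex S G v \<longleftrightarrow> (\<exists>g. complete_numbering S G v g) \<and> even (card (gates_at G v))"

definition partial_vertex :: "'s topology \<Rightarrow> ('s, 'v, 'e) graph_map \<Rightarrow> 'v \<Rightarrow> bool" where
  "partial_vertex S G v \<longleftrightarrow> (\<exists>g. partial_numbering S G v g)"

definition non_odd_vertex :: "'s topology \<Rightarrow> ('s, 'v, 'e) graph_map \<Rightarrow> 'v \<Rightarrow> bool" where
  "non_odd_vertex S G v \<longleftrightarrow> even_vertex S G v \<or> partial_vertex S G v"

text \<open>
  The output of the Bestvina-Handel algorithm is described by its properties: an embedded graph
  carrying a train track map induced by \<open>F\<close>, whose infinitesimal edges form, at each vertex, a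
  polygon with at most one side missing.
\<close>

definition bestvina_handel_train_track ::
    "'s topology \<Rightarrow> ('s \<Rightarrow> 's) \<Rightarrow> ('s, 'v, 'e) graph_map \<Rightarrow> bool" where
  "bestvina_handel_train_track S F G \<longleftrightarrow>
     embedded_graph S G \<and> inclusion_homotopy_equivalence S G \<and>
     train_track_map G \<and> induced_by S G F \<and>
     (\<forall>v. odd_vertex S G v \<or> even_vertex S G v \<or> partial_vertex S G v)"

text \<open>
  An orientation of the branches of \<open>\<tau>\<close> consists of a direction \<open>\<omega>\<close> of each real edge and of the
  gate \<open>\<kappa> B\<close> towards which the infinitesimal edge \<open>B\<close> points. The switches of \<open>\<tau>\<close> are the gates.
\<close>

definition towards :: "('e \<Rightarrow> bool) \<Rightarrow> 'e dart \<Rightarrow> bool" where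
  "towards \<omega> d \<longleftrightarrow> \<omega> (fst d) \<noteq> snd d"

definition tau_orientation ::
    "('s, 'v, 'e) graph_map \<Rightarrow> ('e \<Rightarrow> bool) \<Rightarrow> ('e gate set \<Rightarrow> 'e gate) \<Rightarrow> bool" where
  "tau_orientation G \<omega> \<kappa> \<longleftrightarrow>
     (\<forall>v. \<forall>B\<in>infinitesimal_edges G v. \<kappa> B \<in> B) \<and>
     (\<forall>v. \<forall>g\<in>gates_at G v.
        (\<forall>d\<in>g. towards \<omega> d) \<and> (\<forall>B\<in>infinitesimal_edges G v. g \<in> B \<longrightarrow> \<kappa> B \<noteq> g) \<or>
        (\<forall>d\<in>g. \<not> towards \<omega> d) \<and> (\<forall>B\<in>infinitesimal_edges G v. g \<in> B \<longrightarrow> \<kappa> B = g))"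

definition tau_orientable :: "('s, 'v, 'e) graph_map \<Rightarrow> bool" where
  "tau_orientable G \<longleftrightarrow> (\<exists>\<omega> \<kappa>. tau_orientation G \<omega> \<kappa>)"

datatype 'e branch = Real_edge 'e | Infinitesimal "'e gate set"

text \<open>Weights vanish on those elements of the type that are not branches of \<open>\<tau>\<close>.\<close>

definition W_tau :: "('s, 'v, 'e) graph_map \<Rightarrow> ('e branch \<Rightarrow> real) set" where
  "W_tau G =
     {w. (\<forall>B. (\<forall>v. B \<notin> infinitesimal_edges G v) \<longrightarrow> w (Infinitesimal B) = 0) \<and>
         (\<forall>v. \<forall>g\<in>gates_at G v.
            (\<Sum>d\<in>g. w (Real_edge (fst d))) =
            (\<Sum>B | B \<in> infinitesimal_edges G v \<and> g \<in> B. w (Infinitesimal B)))}"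

definition collapse :: "('e::finite branch \<Rightarrow> real) \<Rightarrow> real^'e" where
  "collapse w = vec_lambda (\<lambda>e. w (Real_edge e))"

definition W_graph :: "('s, 'v, 'e::finite) graph_map \<Rightarrow> (real^'e) set" where
  "W_graph G = collapse ` W_tau G"

section \<open>The map delta\<close>

definition gate_weight :: "real^'e \<Rightarrow> 'e::finite gate \<Rightarrow> real" where
  "gate_weight \<eta> g = (\<Sum>d\<in>g. vec_nth \<eta> (fst d))"

text \<open>
  Admissible gate signs: those of an orientation of \<open>\<tau>\<close> if there is one, and otherwise signs that
  alternate at each non-odd vertex, independently of the other vertices.
\<close>

definition gate_signs ::
    "'s topology \<Rightarrow> ('s, 'v, 'e) graph_map \<Rightarrow> ('e gate \<Rightarrow> real) \<Rightarrow> bool" where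
  "gate_signs S G s \<longleftrightarrow>
     (if tau_orientable G
      then \<exists>\<omega> \<kappa>. tau_orientation G \<omega> \<kappa> \<and>
             (\<forall>v. \<forall>g\<in>gates_at G v. \<forall>d\<in>g. s g = (if towards \<omega> d then 1 else -1))
      else \<forall>v. non_odd_vertex S G v \<longrightarrow>
             (\<exists>g \<epsilon>. (complete_numbering S G v g \<or> partial_numbering S G v g) \<and>
                \<epsilon> \<in> {1, -1} \<and> (\<forall>i<card (gates_at G v). s (g i) = \<epsilon> * (-1) ^ i)))"

text \<open>
  The target \<open>\<real>\<^sup>m\<close>, with one coordinate for each non-odd vertex, is realised as the coordinate
  subspace of \<open>real^'v\<close> in which the coordinates of the odd vertices vanish.
\<close>

definition delta ::
    "'s topology \<Rightarrow> ('s, 'v::finite, 'e::finite) graph_map \<Rightarrow> ('e gate \<Rightarrow> real) \<Rightarrow>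
     real^'e \<Rightarrow> real^'v" where
  "delta S G s \<eta> = vec_lambda (\<lambda>v. if non_odd_vertex S G v
     then (\<Sum>g\<in>gates_at G v. s g * gate_weight \<eta> g) else 0)"

section \<open>Characteristic polynomials of endomorphisms of subspaces\<close>

text \<open>
  The determinant of \<open>x I - \<phi>\<close> for an endomorphism \<open>\<phi>\<close> of a finite-dimensional subspace \<open>U\<close>
  is computed from the matrix of \<open>\<phi>\<close> in an arbitrary basis of \<open>U\<close>.
\<close>

definition char_poly_on :: "'a::euclidean_space set \<Rightarrow> ('a \<Rightarrow> 'a) \<Rightarrow> real poly" where
  "char_poly_on U \<phi> =
     (let bs = (SOME bs. distinct bs \<and> independent (set bs) \<and> span (set bs) = U)
      in char_poly (Matrix.mat (length bs) (length bs)
           (\<lambda>(i, j). representation (set bs) (\<phi> (bs ! j)) (bs ! i))))"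

text \<open>
  The map induced by \<open>\<phi>\<close> on the image of \<open>\<delta>\<close>; it is well defined, with
  \<open>induced_on_image \<delta> \<phi> (\<delta> \<eta>) = \<delta> (\<phi> \<eta>)\<close>, if \<open>\<phi>\<close> preserves the kernel of \<open>\<delta>\<close>.
\<close>

definition induced_on_image :: "('a \<Rightarrow> 'b) \<Rightarrow> ('a \<Rightarrow> 'a) \<Rightarrow> 'b \<Rightarrow> 'b" where
  "induced_on_image \<delta> \<phi> y = \<delta> (\<phi> (SOME \<eta>. \<delta> \<eta> = y))"

end

theory Submission
  imports Defs
begin

text \<open>
  Everything rests on a dual description of \<open>W(G,f)\<close>. A function \<open>\<sigma>\<close> on gates is called
  alternating if its values at the two ends of every infinitesimal edge add up to zero, and it
  defines the linear form \<open>\<eta> \<mapsto> \<Sum>d. \<sigma>(gate of d) \<eta>(d)\<close>, the sum ranging over all edge-ends \<open>d\<close>.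
  The switch conditions say that the vector of gate weights of \<open>\<eta>\<close> is a combination of the
  indicator vectors of the infinitesimal edges. A subspace of a Euclidean space is its own double
  orthogonal complement, and the functions orthogonal to all those indicators are the
  alternating ones; so \<open>W(G,f)\<close> is the common kernel of the forms of the alternating functions
  (\<open>W_graph_pairing_zero\<close>, \<open>pairing_zero_imp_W_graph\<close>).

  Invariance of \<open>W(G,f)\<close> under \<open>f\<^sub>*\<close> follows because the transpose of \<open>f\<^sub>*\<close> maps alternating
  functions to alternating functions. In the value of the form of \<open>\<sigma>\<close> on \<open>f\<^sub>*\<eta>\<close>, the
  contributions along the edge-path \<open>f(e)\<close> cancel at each turn of the path, because a turn
  taken by \<open>f(e)\<close> is an infinitesimal edge. Only the two ends of the path survive, and what
  remains is the form of the pulled back function \<open>d \<mapsto> \<sigma>(first edge-end of f(d))\<close>, evaluated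
  at \<open>\<eta>\<close> (\<open>pairing_fstar\<close>). The pulled back function is again alternating since \<open>f\<close> maps
  infinitesimal edges to infinitesimal edges and never folds two different gates at a vertex
  into one (\<open>infinitesimal_edge_image\<close>, \<open>alternating_pullback\<close>).

  At one vertex, the infinitesimal edges connect all gates in a chain, so an alternating function
  is determined by one value. It vanishes around an odd polygon, and at a non-odd vertex it is a
  multiple of the alternating signs that define \<open>\<delta>\<close>. Hence the alternating functions
  correspond to the functions \<open>c\<close> on the non-odd vertices, the form of \<open>c\<close> is
  \<open>\<eta> \<mapsto> c \<bullet> \<delta>(\<eta>)\<close>, and \<open>ker \<delta> = W(G,f)\<close> (\<open>inner_delta\<close>, \<open>kernel_delta\<close>).

  For the rank of \<open>\<delta>\<close>, consider a vector \<open>c\<close> orthogonal to its image. It has to satisfy one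
  equation for each edge: the values at the two ends of the edge, multiplied by the signs and
  replaced by zero at odd vertices, cancel. In particular \<open>\<bar>c\<bar>\<close>, so modified, takes the same value at both ends of an edge. The graph is
  connected, since the surface is a quotient of the disc and the graph is homotopy equivalent to
  it, so \<open>\<bar>c\<bar>\<close> is constant. If the constant is not zero, there are no odd vertices, and the signs of
  the products orient the train track (\<open>balanced_weights_imp_orientable\<close>). Thus \<open>\<delta>\<close> is onto if
  \<open>\<tau>\<close> is not orientable. If \<open>\<tau>\<close> is oriented, \<open>\<delta>\<close> is the incidence matrix of a connected
  directed graph, and only the constant vectors are orthogonal to its image.

  The remaining claims are linear algebra: the domain of a linear map is the sum of its kernel and
  its image, and an endomorphism that preserves the kernel is block triangular in a basis that
  extends one of the kernel (\<open>char_poly_on_kernel_times_image\<close>).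
\<close>

section \<open>Characteristic polynomials on subspaces\<close>

definition basis_list :: "'a::euclidean_space list \<Rightarrow> 'a set \<Rightarrow> bool" where
  "basis_list bs U \<longleftrightarrow> distinct bs \<and> independent (set bs) \<and> span (set bs) = U"

text \<open>
  The matrix of a map with respect to a pair of bases. With different bases on both sides the
  identity gives the change of basis, so that independence of the basis becomes an instance of
  multiplicativity.
\<close>

definition matrix_of ::
    "'b::euclidean_space list \<Rightarrow> 'a::euclidean_space list \<Rightarrow> ('a \<Rightarrow> 'b) \<Rightarrow> real mat" where
  "matrix_of bs cs \<phi> =
     Matrix.mat (length bs) (length cs) (\<lambda>(i, j). representation (set bs) (\<phi> (cs ! j)) (bs ! i))"

lemma matrix_of_carrier [simp]: "matrix_of bs cs \<phi> \<in> carrier_mat (length bs) (length cs)"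
  by (simp add: matrix_of_def)

lemma matrix_of_dim [simp]:
  "dim_row (matrix_of bs cs \<phi>) = length bs" "dim_col (matrix_of bs cs \<phi>) = length cs"
  by (simp_all add: matrix_of_def)

lemma matrix_of_index [simp]:
  "i < length bs \<Longrightarrow> j < length cs \<Longrightarrow>
     matrix_of bs cs \<phi> $$ (i, j) = representation (set bs) (\<phi> (cs ! j)) (bs ! i)"
  by (simp add: matrix_of_def)

lemma subspace_basis_list:
  assumes "subspace U"
  obtains bs where "basis_list bs U"
proof -
  obtain B where B: "B \<subseteq> U" "independent B" "U \<subseteq> span B"
    using basis_exists by metis
  moreover have "finite B"
    using B(2) independent_bound by auto
  then obtain bs where "set bs = B" "distinct bs"
    using finite_distinct_list by metis
  moreover have "span B = U"
    using B assms span_minimal[OF B(1)] by auto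
  ultimately show thesis
    by (intro that[of bs]) (auto simp: basis_list_def)
qed

text \<open>
  \<open>char_poly_on\<close> refers to a basis chosen by Hilbert's operator; this is the only place where that
  choice is opened.
\<close>

lemma char_poly_on_chosen_basis:
  assumes "subspace U"
  obtains bs where "basis_list bs U" "\<And>\<phi>. char_poly_on U \<phi> = char_poly (matrix_of bs bs \<phi>)"
proof -
  define bs where "bs = (SOME bs. distinct bs \<and> independent (set bs) \<and> span (set bs) = U)"
  have "\<exists>bs. distinct bs \<and> independent (set bs) \<and> span (set bs) = U"
    using subspace_basis_list[OF assms] unfolding basis_list_def by blast
  then have "basis_list bs U"
    unfolding basis_list_def bs_def by (rule someI_ex)
  then show thesis
    by (rule that) (simp add: char_poly_on_def Let_def bs_def matrix_of_def)
qed

lemma basis_list_length: "basis_list bs U \<Longrightarrow> length bs = dim U"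
  by (metis basis_list_def dim_span distinct_card dim_eq_card_independent)

lemma representation_linear_image:
  fixes \<phi> :: "'a::euclidean_space \<Rightarrow> 'b::euclidean_space"
  assumes "linear \<phi>" "independent C" "independent D" "\<phi> ` C \<subseteq> span D" "x \<in> span C"
  shows "representation D (\<phi> x) d = (\<Sum>c\<in>C. representation C x c * representation D (\<phi> c) d)"
proof -
  have fin: "finite C"
    using assms(2) independent_bound by auto
  have "\<phi> x = \<phi> (\<Sum>c\<in>C. representation C x c *\<^sub>R c)"
    using assms(2,5) fin by (simp add: sum_representation_eq)
  also have "\<dots> = (\<Sum>c\<in>C. representation C x c *\<^sub>R \<phi> c)"
    by (simp add: linear_sum[OF assms(1)] linear_scale[OF assms(1)])
  finally show ?thesis
    using assms(3,4) by (auto simp: representation_sum representation_scale span_scale image_subset_iff)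
qed

lemma matrix_of_mult:
  fixes \<phi> :: "'b::euclidean_space \<Rightarrow> 'c::euclidean_space" and \<psi> :: "'a::euclidean_space \<Rightarrow> 'b"
  assumes "linear \<phi>" "distinct cs" "independent (set cs)" "independent (set bs)"
    and "\<phi> ` set cs \<subseteq> span (set bs)" "\<psi> ` set ds \<subseteq> span (set cs)"
  shows "matrix_of bs cs \<phi> * matrix_of cs ds \<psi> = matrix_of bs ds (\<phi> \<circ> \<psi>)"
proof (rule eq_matI)
  fix i j assume "i < dim_row (matrix_of bs ds (\<phi> \<circ> \<psi>))" "j < dim_col (matrix_of bs ds (\<phi> \<circ> \<psi>))"
  then have ij: "i < length bs" "j < length ds" by auto
  let ?x = "\<psi> (ds ! j)" and ?b = "bs ! i"
  have "?x \<in> span (set cs)"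
    using assms(6) ij by auto
  then have "representation (set bs) (\<phi> ?x) ?b =
      (\<Sum>c\<in>set cs. representation (set cs) ?x c * representation (set bs) (\<phi> c) ?b)"
    using assms by (intro representation_linear_image) auto
  also have "\<dots> = (\<Sum>k<length cs. representation (set cs) ?x (cs ! k) *
      representation (set bs) (\<phi> (cs ! k)) ?b)"
    using bij_betw_nth[OF assms(2) refl refl]
    by (rule sum.reindex_bij_betw[symmetric])
  finally show "(matrix_of bs cs \<phi> * matrix_of cs ds \<psi>) $$ (i, j) = matrix_of bs ds (\<phi> \<circ> \<psi>) $$ (i, j)"
    using ij by (simp add: scalar_prod_def atLeast0LessThan mult.commute)
qed auto

lemma matrix_of_id:
  assumes "distinct bs" "independent (set bs)"
  shows "matrix_of bs bs id = 1\<^sub>m (length bs)"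
  by (rule eq_matI) (use assms in \<open>auto simp: representation_basis nth_eq_iff_index_eq\<close>)

text \<open>
  The matrices in two bases are conjugate by the change of basis.
\<close>

lemma char_poly_on_eq_matrix_of:
  assumes "basis_list bs U" "linear \<phi>" "\<phi> ` U \<subseteq> U"
  shows "char_poly_on U \<phi> = char_poly (matrix_of bs bs \<phi>)"
proof -
  have "subspace U"
    using assms(1) by (auto simp: basis_list_def)
  then obtain cs where cs: "basis_list cs U"
    and char_poly: "\<And>\<phi>. char_poly_on U \<phi> = char_poly (matrix_of cs cs \<phi>)"
    using char_poly_on_chosen_basis by blast
  have len: "length cs = length bs"
    using cs assms(1) by (simp add: basis_list_length)
  have sub: "set bs \<subseteq> U" "set cs \<subseteq> U" "\<phi> ` set bs \<subseteq> U" "\<phi> ` set cs \<subseteq> U"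
    using cs assms(1,3) span_superset unfolding basis_list_def by blast+
  note facts = sub cs[unfolded basis_list_def] assms(1)[unfolded basis_list_def] 
  let ?P = "matrix_of cs bs id" and ?Q = "matrix_of bs cs id"
  have PQ: "?P * ?Q = 1\<^sub>m (length cs)" and QP: "?Q * ?P = 1\<^sub>m (length cs)"
    using facts len by (simp_all add: matrix_of_mult matrix_of_id linear_id)
  have eq: "matrix_of cs cs \<phi> = ?P * matrix_of bs bs \<phi> * ?Q"
    using facts by (subst matrix_of_mult; auto simp: linear_id matrix_of_mult assms(2))
  have "{matrix_of cs cs \<phi>, matrix_of bs bs \<phi>, ?P, ?Q} \<subseteq> carrier_mat (length cs) (length cs)"
    using len matrix_of_carrier by (metis empty_subsetI insert_subset)
  then have "similar_mat (matrix_of cs cs \<phi>) (matrix_of bs bs \<phi>)"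
    by (rule similar_matI[OF _ PQ QP eq])
  then show ?thesis
    by (simp add: char_poly char_poly_similar)
qed

lemma char_poly_on_cong:
  assumes "subspace U" "\<And>x. x \<in> U \<Longrightarrow> \<phi> x = \<psi> x"
  shows "char_poly_on U \<phi> = char_poly_on U \<psi>"
proof -
  obtain bs where bs: "basis_list bs U"
    and char_poly: "\<And>\<phi>. char_poly_on U \<phi> = char_poly (matrix_of bs bs \<phi>)"
    using char_poly_on_chosen_basis[OF assms(1)] by blast
  have "set bs \<subseteq> U"
    using bs span_superset by (auto simp: basis_list_def)
  then have "matrix_of bs bs \<phi> = matrix_of bs bs \<psi>"
    by (intro eq_matI) (auto simp: assms(2) subset_iff)
  then show ?thesis
    by (simp add: char_poly)
qed

lemma degree_char_poly_on:
  assumes "subspace U"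
  shows "degree (char_poly_on U \<phi>) = dim U"
proof -
  obtain bs where "basis_list bs U" "char_poly_on U \<phi> = char_poly (matrix_of bs bs \<phi>)"
    using char_poly_on_chosen_basis[OF assms] by metis
  then show ?thesis
    by (metis degree_monic_char_poly[OF matrix_of_carrier] basis_list_length)
qed

lemma char_poly_four_block_lower_left_zero:
  fixes A :: "'a::idom mat"
  assumes "A \<in> carrier_mat n n" "B \<in> carrier_mat n m" "D \<in> carrier_mat m m"
  shows "char_poly (four_block_mat A B (0\<^sub>m m n) D) = char_poly A * char_poly D"
proof -
  let ?cm = "\<lambda>A. [:0, 1:] \<cdot>\<^sub>m 1\<^sub>m (dim_row A) + map_mat (\<lambda>a. [:- a:]) A"
  let ?M = "four_block_mat A B (0\<^sub>m m n) D"
  have "char_poly ?M = Determinant.det (?cm ?M)"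
    unfolding char_poly_defs using assms by simp
  also have "?cm ?M = four_block_mat (?cm A) (map_mat (\<lambda>a. [:- a:]) B) (0\<^sub>m m n) (?cm D)"
    using assms by (intro eq_matI) (auto simp: one_poly_def)
  also have "Determinant.det \<dots> = Determinant.det (?cm A) * Determinant.det (?cm D)"
    using assms by (intro det_four_block_mat_lower_left_zero) auto
  finally show ?thesis
    unfolding char_poly_defs .
qed

text \<open>
  Extend a basis of the kernel of \<open>\<delta>\<close> to the whole space. The map \<open>\<delta>\<close> carries the added vectors to
  a basis of its image. In the extended basis \<open>f\<close> is block upper triangular; the upper left
  block is the matrix of \<open>f\<close> on the kernel, and the lower right block is the matrix of \<open>g\<close>.
\<close>

lemma char_poly_on_kernel_times_image:
  fixes f :: "'a::euclidean_space \<Rightarrow> 'a" and \<delta> :: "'a \<Rightarrow> 'b::euclidean_space"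
  assumes f: "linear f" and \<delta>: "linear \<delta>" and g: "linear g"
    and comm: "\<And>x. g (\<delta> x) = \<delta> (f x)"
  shows "char_poly_on UNIV f = char_poly_on {x. \<delta> x = 0} f * char_poly_on (range \<delta>) g"
proof -
  let ?W = "{x. \<delta> x = 0}"
  have W: "subspace ?W"
    using \<delta> by (rule linear_subspace_kernel)
  have fW: "f ` ?W \<subseteq> ?W"
    using comm by (auto simp: linear_0[OF g] simp flip: comm)
  obtain bs where bs: "basis_list bs ?W"
    using subspace_basis_list[OF W] .
  obtain C where C: "set bs \<subseteq> C" "independent C" "UNIV \<subseteq> span C"
    using maximal_independent_subset_extend[of "set bs" UNIV] bs by (auto simp: basis_list_def)
  have "finite (C - set bs)"
    using C(2) independent_bound by blast
  then obtain cs where cs: "set cs = C - set bs" "distinct cs"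
    using finite_distinct_list by metis
  have bcs: "basis_list (bs @ cs) UNIV"
    using bs cs C by (auto simp: basis_list_def Un_absorb1)
  have bs0: "\<delta> b = 0" if "b \<in> set bs" for b
    using that bs span_superset unfolding basis_list_def by blast
  \<comment> \<open>only the added vectors matter for the value of the map, the kernel part of the basis drops out\<close>
  have repr: "\<delta> x = (\<Sum>c\<in>set cs. representation C x c *\<^sub>R \<delta> c)" for x
  proof -
    have fC: "finite C" using C(2) independent_bound by blast
    have "\<delta> x = \<delta> (\<Sum>c\<in>C. representation C x c *\<^sub>R c)"
      using C by (subst sum_representation_eq) (auto simp: fC)
    also have "\<dots> = (\<Sum>c\<in>C. representation C x c *\<^sub>R \<delta> c)"
      by (simp add: linear_sum[OF \<delta>] linear_scale[OF \<delta>])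
    also have "\<dots> = (\<Sum>c\<in>set cs. representation C x c *\<^sub>R \<delta> c)"
      using C(1) cs(1) bs0 fC by (intro sum.mono_neutral_right) auto
    finally show ?thesis .
  qed
  have inj: "inj_on \<delta> (span (set cs))"
  proof -
    have "x = 0" if "x \<in> span (set cs)" "\<delta> x = 0" for x
    proof -
      have "x \<in> span (set bs)"
        using that bs by (auto simp: basis_list_def)
      then have "representation C x = representation (set bs) x"
        using C by (intro representation_extend)
      moreover have "representation C x = representation (set cs) x"
        using C cs that by (intro representation_extend) auto
      ultimately have "representation C x c = 0" for c
        using representation_ne_zero[of "set bs" x c] representation_ne_zero[of "set cs" x c] cs(1)
        by auto
      moreover have "(\<Sum>c\<in>C. representation C x c *\<^sub>R c) = x"
        using C independent_bound[of C] by (intro sum_representation_eq) auto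
      ultimately show ?thesis
        by simp
    qed
    then show ?thesis
      by (simp add: linear_inj_on_iff_eq_0[OF \<delta> subspace_span])
  qed
  let ?ds = "map \<delta> cs"
  have ind: "independent (\<delta> ` set cs)"
    using inj independent_mono[OF C(2)] cs(1) by (intro linear_independent_injective_image[OF \<delta>]) auto
  have inj': "inj_on \<delta> (set cs)"
    by (rule inj_on_subset[OF inj span_superset])
  have ds: "basis_list ?ds (range \<delta>)"
    unfolding basis_list_def
  proof (intro conjI subset_antisym)
    show "distinct ?ds" using cs(2) inj' by (simp add: distinct_map)
    show "independent (set ?ds)" using ind by simp
    show "span (set ?ds) \<subseteq> range \<delta>"
      by (rule span_minimal) (auto simp: linear_subspace_image[OF \<delta> subspace_UNIV])
    show "range \<delta> \<subseteq> span (set ?ds)"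
    proof clarify
      fix x show "\<delta> x \<in> span (set ?ds)"
        by (subst repr) (intro span_sum span_scale span_base, simp)
    qed
  qed
  \<comment> \<open>the two diagonal blocks, read off from the coordinates of the images of the basis vectors\<close>
  have A: "representation C (f b) = representation (set bs) (f b)" if "b \<in> set bs" for b
  proof (rule representation_extend[OF C(2) _ C(1)])
    have "b \<in> ?W" using bs0[OF that] by simp
    then show "f b \<in> span (set bs)"
      using fW bs unfolding basis_list_def by auto
  qed
  have D: "representation (\<delta> ` set cs) (g (\<delta> x)) (\<delta> c) = representation C (f x) c" if "c \<in> set cs" for x c
  proof -
    have "representation (\<delta> ` set cs) (\<delta> (f x)) (\<delta> c) =
       (\<Sum>k\<in>set cs. representation C (f x) k * representation (\<delta> ` set cs) (\<delta> k) (\<delta> c))"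
      by (subst repr) (simp add: representation_sum[OF ind] representation_scale[OF ind] span_scale span_base)
    also have "\<dots> = (\<Sum>k\<in>set cs. if k = c then representation C (f x) k else 0)"
      using inj' that by (intro sum.cong) (auto simp: representation_basis[OF ind] inj_on_eq_iff)
    finally show ?thesis using that by (simp add: comm)
  qed
  have Ceq: "set (bs @ cs) = C"
    using C cs by auto
  have "matrix_of (bs @ cs) (bs @ cs) f =
     four_block_mat (matrix_of bs bs f) (Matrix.mat (length bs) (length cs)
        (\<lambda>(i, j). representation C (f (cs ! j)) (bs ! i)))
        (0\<^sub>m (length cs) (length bs)) (matrix_of ?ds ?ds g)" (is "_ = four_block_mat ?A ?B _ ?D")
  proof (rule eq_matI, goal_cases)
    case (1 i j)
    have 0: "representation (set bs) x (cs ! k) = 0" if "k < length cs" for x k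
      using representation_ne_zero[of "set bs" x "cs ! k"] nth_mem[OF that] cs(1) by auto
    from 1 show ?case
      using A D 0 Ceq by (auto simp: nth_append simp del: set_append)
  qed auto
  moreover have "char_poly (four_block_mat ?A ?B (0\<^sub>m (length cs) (length bs)) ?D) =
      char_poly ?A * char_poly ?D"
    using matrix_of_carrier[of ?ds ?ds g]
    by (intro char_poly_four_block_lower_left_zero) auto
  moreover have "g ` range \<delta> \<subseteq> range \<delta>"
    by (auto simp: comm)
  ultimately show ?thesis
    using char_poly_on_eq_matrix_of[OF bcs f] char_poly_on_eq_matrix_of[OF bs f fW]
      char_poly_on_eq_matrix_of[OF ds g] by simp
qed

text \<open>
  A linear right inverse \<open>r\<close> of \<open>\<delta>\<close> on its image makes \<open>x - r (\<delta> x)\<close> a projection onto the kernel.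
\<close>

lemma kernel_image_decomposition:
  fixes \<delta> :: "'a::euclidean_space \<Rightarrow> 'b::euclidean_space"
  assumes "linear \<delta>"
  obtains \<Phi> :: "'a \<Rightarrow> 'a \<times> 'b" where "linear \<Phi>" "bij_betw \<Phi> UNIV ({x. \<delta> x = 0} \<times> range \<delta>)"
proof -
  obtain r where r: "linear r" "\<And>y. y \<in> range \<delta> \<Longrightarrow> \<delta> (r y) = y"
    using linear_exists_right_inverse_on[OF assms subspace_UNIV] by auto
  define \<Phi> where "\<Phi> x = (x - r (\<delta> x), \<delta> x)" for x
  have "linear \<Phi>"
    unfolding \<Phi>_def using assms r(1)
    by (intro linearI) (auto simp: linear_add linear_scale algebra_simps)
  moreover have "bij_betw \<Phi> UNIV ({x. \<delta> x = 0} \<times> range \<delta>)"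
  proof (rule bij_betwI[where g = "\<lambda>(w, y). w + r y"])
    show "\<Phi> \<in> UNIV \<rightarrow> {x. \<delta> x = 0} \<times> range \<delta>"
      using r(2) by (auto simp: \<Phi>_def linear_diff[OF assms])
    show "\<Phi> (case p of (w, y) \<Rightarrow> w + r y) = p" if "p \<in> {x. \<delta> x = 0} \<times> range \<delta>" for p
      using that r(2) by (auto simp: \<Phi>_def linear_add[OF assms])
  qed (auto simp: \<Phi>_def)
  ultimately show thesis
    by (rule that)
qed

lemma dim_kernel_plus_dim_image:
  fixes \<delta> :: "'a::euclidean_space \<Rightarrow> 'b::euclidean_space"
  assumes "linear \<delta>"
  shows "dim {x. \<delta> x = 0} + dim (range \<delta>) = DIM('a)"
proof -
  obtain \<Phi> :: "'a \<Rightarrow> 'a \<times> 'b" where \<Phi>: "linear \<Phi>" "bij_betw \<Phi> UNIV ({x. \<delta> x = 0} \<times> range \<delta>)"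
    using kernel_image_decomposition[OF assms] .
  have "dim ({x. \<delta> x = 0} \<times> range \<delta>) = dim (UNIV :: 'a set)"
    using \<Phi> dim_image_eq[of \<Phi> UNIV] by (simp add: bij_betw_def)
  moreover have "dim ({x. \<delta> x = 0} \<times> range \<delta>) = dim {x. \<delta> x = 0} + dim (range \<delta>)"
    using assms by (intro dim_Times linear_subspace_kernel linear_subspace_image subspace_UNIV)
  ultimately show ?thesis by simp
qed

section \<open>Connectedness of the graph\<close>

text \<open>
  The universal cover is the disc, and a quotient of a connected space is connected.
\<close>

lemma hyperbolic_imp_connected_space:
  assumes "admits_hyperbolic_structure S A"
  shows "connected_space S"
proof -
  have "\<exists>p. quotient_map (top_of_set (ball 0 1 :: complex set)) S p"
    using assms unfolding admits_hyperbolic_structure_def by (rule ex_forward) (erule conjunct1)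
  then obtain p where "quotient_map (top_of_set (ball 0 1 :: complex set)) S p" ..
  moreover have "connected_space (top_of_set (ball 0 1 :: complex set))"
    by (simp add: connected_space_subtopology connectedin_iff_connected)
  ultimately show ?thesis
    by (rule connected_space_quotient_map_image)
qed

text \<open>
  The image of a homotopy inverse \<open>r\<close> is connected, and the track of the homotopy from \<open>r\<close> to the
  identity joins every point of the graph to that image.
\<close>

lemma connected_graph_space:
  assumes "inclusion_homotopy_equivalence S G" "connected_space S"
  shows "connected_space (graph_space S G)"
proof -
  obtain r where r: "continuous_map S (graph_space S G) r"
    and hom: "homotopic_with (\<lambda>_. True) (graph_space S G) (graph_space S G) r id"
    using assms(1) unfolding inclusion_homotopy_equivalence_def by blast
  let ?Y = "graph_space S G"
  obtain h where h: "continuous_map (prod_topology (top_of_set {0..1::real}) ?Y) ?Y h"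
    and h0: "\<And>x. h (0, x) = r x" and h1: "\<And>x. h (1, x) = x"
    using hom unfolding homotopic_with_def by auto
  \<comment> \<open>the track of a point under the homotopy\<close>
  let ?path = "\<lambda>x. h ` ({0..1} \<times> {x})"
  let ?\<C> = "(\<lambda>x. r ` topspace S \<union> ?path x) ` topspace ?Y"
  have "connectedin ?Y (r ` topspace S \<union> ?path x)" if "x \<in> topspace ?Y" for x
  proof (rule connectedin_Un)
    show "connectedin ?Y (r ` topspace S)"
      using assms(2) by (intro connectedin_continuous_map_image[OF r]) (simp add: connectedin_topspace)
    have "connectedin (prod_topology (top_of_set {0..1}) ?Y) ({0..1::real} \<times> {x})"
      using that by (simp add: connectedin_Times connectedin_subtopology)
    then show "connectedin ?Y (?path x)"
      by (rule connectedin_continuous_map_image[OF h])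
    have "x \<in> topspace S"
      using that by (simp add: graph_space_def)
    moreover have "r x \<in> ?path x"
      using h0[of x] by (intro image_eqI[of _ _ "(0, x)"]) auto
    ultimately show "r ` topspace S \<inter> ?path x \<noteq> {}"
      by blast
  qed
  then have "connectedin ?Y (\<Union> ?\<C>)" if "topspace S \<noteq> {}"
    using that by (intro connectedin_Union) auto
  moreover have "x \<in> ?path x" for x
    using h1[of x] by (intro image_eqI[of _ _ "(1, x)"]) auto
  then have "topspace ?Y \<subseteq> \<Union> ?\<C>"
    by blast
  moreover have "connected_space ?Y" if "topspace S = {}"
    using that by (simp add: graph_space_def connected_space_def)
  ultimately show ?thesis
    by (metis connectedin_subset_topspace connectedin_topspace subset_antisym)
qed

lemma compactin_arc:
  assumes "embedded_graph S G"
  shows "compactin S (arc G e ` {0..1})"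
proof -
  have "pathin S (arc G e)"
    using assms unfolding embedded_graph_def by blast
  then have "continuous_map (top_of_set {0..1}) S (arc G e)"
    by (simp add: pathin_def)
  moreover have "compactin (top_of_set {0..1::real}) {0..1}"
    by (simp add: compactin_subtopology)
  ultimately show ?thesis
    using image_compactin by blast
qed

lemma arc_meets_pos:
  assumes "embedded_graph S G" "arc G e t = pos G v" "t \<in> {0..1}"
  shows "v = base G (e, True) \<or> v = base G (e, False)"
proof -
  have "inj (pos G)" and ends: "arc G e 0 = pos G (base G (e, True))" "arc G e 1 = pos G (base G (e, False))"
    and "arc G e ` {0<..<1} \<inter> range (pos G) = {}"
    using assms(1) unfolding embedded_graph_def by blast+
  moreover have "t = 0 \<or> t = 1"
  proof (rule ccontr)
    assume "\<not> (t = 0 \<or> t = 1)"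
    then have "arc G e t \<in> arc G e ` {0<..<1}"
      using assms(3) by auto
    then show False
      using calculation(4) assms(2) by blast
  qed
  ultimately show ?thesis
    using assms(2) by (metis injD)
qed

lemma arc_meets_arc:
  assumes "embedded_graph S G" "arc G e t = arc G e' t'" "t \<in> {0..1}" "t' \<in> {0..1}" "e \<noteq> e'"
  obtains v where "arc G e t = pos G v"
proof (cases "t \<in> {0<..<1} \<and> t' \<in> {0<..<1}")
  case True
  have "arc G e ` {0<..<1} \<inter> arc G e' ` {0<..<1} = {}"
    using assms(1,5) unfolding embedded_graph_def by blast
  then show thesis
    using True assms(2) by (metis IntI emptyE imageI)
next
  case False
  then have "t = 0 \<or> t = 1 \<or> t' = 0 \<or> t' = 1"
    using assms(3,4) by auto
  moreover have "arc G d 0 = pos G (base G (d, True))" "arc G d 1 = pos G (base G (d, False))" for d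
    using assms(1) unfolding embedded_graph_def by blast+
  ultimately show thesis
    using that assms(2) by metis
qed

text \<open>
  Topological connectedness of the graph implies combinatorial connectedness: the part of the graph
  over a level set of \<open>c\<close> and the part over its complement are disjoint, because arcs meet only in
  common endpoints, and both are closed, being finite unions of compact arcs in a Hausdorff space.
\<close>

lemma edge_invariant_function_constant:
  fixes G :: "('s, 'v::finite, 'e::finite) graph_map"
  assumes emb: "embedded_graph S G" and "Hausdorff_space S" and conn: "connected_space (graph_space S G)"
    and inv: "\<And>e. c (base G (e, True)) = c (base G (e, False))"
  shows "c u = c v"
proof (rule ccontr)
  assume neq: "c u \<noteq> c v"
  \<comment> \<open>for a set of vertices invariant along the edges, the part of the graph over it\<close>
  define K where "K V = pos G ` V \<union> (\<Union>e\<in>{e. base G (e, True) \<in> V}. arc G e ` {0..1})" for V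
  have posS: "range (pos G) \<subseteq> topspace S"
    using emb by (simp add: embedded_graph_def)
  have K_closed: "closedin (graph_space S G) (K V)" for V
  proof -
    have "compactin S (K V)"
      unfolding K_def
    proof (rule compactin_Un)
      show "compactin S (pos G ` V)"
        using posS by (intro finite_imp_compactin) auto
      show "compactin S (\<Union>e\<in>{e. base G (e, True) \<in> V}. arc G e ` {0..1})"
        using compactin_arc[OF emb] by (intro compactin_Union) auto
    qed
    then have "closedin S (K V)"
      using assms(2) by (rule compactin_imp_closedin[rotated])
    moreover have "K V \<subseteq> range (pos G) \<union> (\<Union>e. arc G e ` {0..1})"
      unfolding K_def by blast
    ultimately show ?thesis
      unfolding graph_space_def by (intro closedin_subset_topspace)
  qed
  define V where "V = {x. c x = c u}"
  have V_inv: "base G (e, True) \<in> V \<longleftrightarrow> base G (e, False) \<in> V" for e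
    using inv by (simp add: V_def)
  have pos_K: "x \<in> U" if "pos G x \<in> K U" "\<And>e. base G (e, True) \<in> U \<longleftrightarrow> base G (e, False) \<in> U" for x U
    using that(1) unfolding K_def
  proof (elim UnE UN_E)
    assume "pos G x \<in> pos G ` U"
    then show "x \<in> U"
      using emb unfolding embedded_graph_def by (auto dest: injD)
  next
    fix e assume e: "e \<in> {e. base G (e, True) \<in> U}" "pos G x \<in> arc G e ` {0..1}"
    then obtain t where "arc G e t = pos G x" "t \<in> {0..1}"
      by (metis imageE)
    then have "x = base G (e, True) \<or> x = base G (e, False)"
      by (rule arc_meets_pos[OF emb])
    then show "x \<in> U"
      using e(1) that(2)[of e] by auto
  qed
  have "K V \<inter> K (- V) = {}"
  proof (rule ccontr)
    assume "K V \<inter> K (- V) \<noteq> {}"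
    then obtain y where y: "y \<in> K V" "y \<in> K (- V)" by blast
    have "\<exists>x. y = pos G x"
    proof (rule ccontr)
      assume no: "\<nexists>x. y = pos G x"
      have arcs: "\<exists>e t. base G (e, True) \<in> U \<and> y = arc G e t \<and> t \<in> {0..1}" if "y \<in> K U" for U
        using that no unfolding K_def by blast
      obtain e t e' t' where e: "base G (e, True) \<in> V" "y = arc G e t" "t \<in> {0..1}"
        "base G (e', True) \<in> - V" "y = arc G e' t'" "t' \<in> {0..1}"
        using arcs[OF y(1)] arcs[OF y(2)] by blast
      then have "arc G e t = arc G e' t'" "e \<noteq> e'"
        using e by auto
      then obtain x where "arc G e t = pos G x"
        using arc_meets_arc[OF emb] e by metis
      then have "y = pos G x"
        using e(2) by simp
      then show False
        using no by blast
    qed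
    then obtain x where "y = pos G x" by blast
    then have "x \<in> V" "x \<in> - V"
      using y pos_K[of x V] pos_K[of x "- V"] V_inv by auto
    then show False by simp
  qed
  moreover have "topspace (graph_space S G) \<subseteq> K V \<union> K (- V)"
    unfolding graph_space_def K_def topspace_subtopology by blast
  moreover have "pos G u \<in> K V" "pos G v \<in> K (- V)"
    using neq by (auto simp: K_def V_def)
  ultimately show False
    using conn K_closed unfolding connected_space_closedin by blast
qed

section \<open>Edge-paths, gates and their images\<close>

lemma flip_flip [simp]: "flip (flip d) = d"
  by (cases d) simp

lemma sum_darts: "(\<Sum>d\<in>UNIV. h d) = (\<Sum>e\<in>UNIV. h (e, True) + h (e, False))"
  for h :: "('e::finite) dart \<Rightarrow> real"
proof -
  have "(\<Sum>d\<in>UNIV. h d) = (\<Sum>(e, b)\<in>UNIV \<times> UNIV. h (e, b))"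
    by (simp add: UNIV_Times_UNIV)
  also have "\<dots> = (\<Sum>e\<in>UNIV. \<Sum>b\<in>UNIV. h (e, b))"
    by (simp add: sum.cartesian_product)
  finally show ?thesis
    by (simp add: UNIV_bool add.commute)
qed

lemma sum_list_eq_sum_count:
  "(\<Sum>x\<leftarrow>xs. h x) = (\<Sum>i\<in>UNIV. real (count_list xs i) * h i)" for h :: "'e::finite \<Rightarrow> real"
proof (induction xs)
  case (Cons x xs)
  have "real (count_list (x # xs) i) * h i = (if i = x then h i else 0) + real (count_list xs i) * h i" for i
    by (auto simp: algebra_simps)
  then show ?case
    using Cons by (simp add: sum.distrib del: count_list.simps)
qed simp

text \<open>
  A telescoping sum: every interior turn of the path contributes zero.
\<close>

lemma sum_over_path:
  fixes h :: "'e dart \<Rightarrow> real"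
  assumes "p \<noteq> []" "successively (\<lambda>x y. h (flip x) + h y = 0) p"
  shows "(\<Sum>x\<leftarrow>p. h x + h (flip x)) = h (hd p) + h (flip (last p))"
  using assms
proof (induction p rule: induct_list012)
  case (3 x y p)
  then show ?case by (cases p) (auto simp: algebra_simps)
qed auto

lemma dart_image_flip: "dart_image G (flip d) = rev (map flip (dart_image G d))"
  by (cases d) (auto simp: rev_map o_def)

lemma path_image_map_append: "path_image_map G (p @ q) = path_image_map G p @ path_image_map G q"
  by (simp add: path_image_map_def)

lemma path_image_map_funpow_append:
  "(path_image_map G ^^ r) (p @ q) = (path_image_map G ^^ r) p @ (path_image_map G ^^ r) q"
  by (induction r) (simp_all add: path_image_map_append)

lemma path_image_map_reverse:
  "path_image_map G (rev (map flip p)) = rev (map flip (path_image_map G p))"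
  by (induction p) (simp_all add: path_image_map_def dart_image_flip)

lemma iterate_flip: "iterate G r (flip d) = rev (map flip (iterate G r d))"
  unfolding iterate_def by (induction r) (simp_all add: path_image_map_reverse)

lemma iterate_0: "iterate G 0 d = [d]"
  by (simp add: iterate_def)

lemma iterate_Suc: "iterate G (Suc r) d = path_image_map G (iterate G r d)"
  by (simp add: iterate_def)

lemma iterate_1: "iterate G (Suc 0) d = dart_image G d"
  by (simp add: iterate_def path_image_map_def)

lemma iterate_add: "iterate G (r + k) d = (path_image_map G ^^ r) (iterate G k d)"
  by (simp add: iterate_def funpow_add)

text \<open>
  The derivative of the graph map on edge-ends.
\<close>

abbreviation first_dart :: "('s, 'v, 'e) graph_map \<Rightarrow> 'e dart \<Rightarrow> 'e dart" where
  "first_dart G d \<equiv> hd (dart_image G d)"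

locale train_track =
  fixes G :: "('s, 'v::finite, 'e::finite) graph_map"
  assumes train_track: "train_track_map G"
begin

lemma dart_image_nonempty: "dart_image G d \<noteq> []"
  using train_track by (cases d) (auto simp: train_track_map_def)

lemma base_first_dart: "base G (first_dart G d) = vmap G (base G d)"
  using train_track dart_image_nonempty[of d]
  by (cases d) (auto simp: train_track_map_def hd_rev last_map hd_map)

lemma path_image_map_nonempty: "p \<noteq> [] \<Longrightarrow> path_image_map G p \<noteq> []"
  using dart_image_nonempty by (cases p) (auto simp: path_image_map_def)

lemma iterate_nonempty: "iterate G r d \<noteq> []"
  by (induction r) (simp_all add: iterate_0 iterate_Suc path_image_map_nonempty)

lemma hd_path_image_map: "p \<noteq> [] \<Longrightarrow> hd (path_image_map G p) = first_dart G (hd p)"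
  using dart_image_nonempty by (cases p) (auto simp: path_image_map_def)

lemma hd_iterate: "hd (iterate G r d) = (first_dart G ^^ r) d"
  by (induction r) (simp_all add: iterate_0 iterate_Suc hd_path_image_map iterate_nonempty)

text \<open>
  Allowing \<open>r = 0\<close> changes nothing, since edge-ends with a common image keep it under further
  iteration.
\<close>

lemma same_gate_iff:
  "same_gate G d d' \<longleftrightarrow> base G d = base G d' \<and>
     (\<exists>r. (first_dart G ^^ r) d = (first_dart G ^^ r) d')"
proof -
  have "\<exists>r>0. (first_dart G ^^ r) d = (first_dart G ^^ r) d'"
    if "(first_dart G ^^ r) d = (first_dart G ^^ r) d'" for r
    using that by (intro exI[of _ "Suc r"]) simp
  then show ?thesis
    unfolding same_gate_def hd_iterate by blast
qed

lemma first_dart_funpow_mono: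
  assumes "(first_dart G ^^ r) d = (first_dart G ^^ r) d'" "r \<le> k"
  shows "(first_dart G ^^ k) d = (first_dart G ^^ k) d'"
proof -
  have "k = (k - r) + r"
    using assms(2) by simp
  then show ?thesis
    by (metis assms(1) comp_apply funpow_add)
qed

lemma same_gate_refl: "same_gate G d d"
  by (simp add: same_gate_iff)

lemma same_gate_sym: "same_gate G d d' \<Longrightarrow> same_gate G d' d"
  by (metis same_gate_iff)

lemma same_gate_trans:
  assumes "same_gate G a b" "same_gate G b c"
  shows "same_gate G a c"
proof -
  obtain r k where "(first_dart G ^^ r) a = (first_dart G ^^ r) b" "(first_dart G ^^ k) b = (first_dart G ^^ k) c"
    using assms same_gate_iff by blast
  then have "(first_dart G ^^ max r k) a = (first_dart G ^^ max r k) c"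
    using first_dart_funpow_mono[of r a b "max r k"] first_dart_funpow_mono[of k b c "max r k"] by simp
  then show ?thesis
    using assms unfolding same_gate_iff by auto
qed

lemma same_gate_base: "same_gate G d d' \<Longrightarrow> base G d = base G d'"
  by (simp add: same_gate_def)

text \<open>
  The induced map on the gates at a vertex is well defined and injective.
\<close>

lemma same_gate_first_dart:
  assumes "base G d = base G d'"
  shows "same_gate G (first_dart G d) (first_dart G d') \<longleftrightarrow> same_gate G d d'"
proof
  assume "same_gate G (first_dart G d) (first_dart G d')"
  then obtain r where "(first_dart G ^^ r) (first_dart G d) = (first_dart G ^^ r) (first_dart G d')"
    unfolding same_gate_iff by blast
  then have "(first_dart G ^^ Suc r) d = (first_dart G ^^ Suc r) d'"
    by (simp only: funpow_Suc_right comp_apply)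
  then show "same_gate G d d'"
    using assms unfolding same_gate_iff by blast
next
  assume "same_gate G d d'"
  then obtain r where "(first_dart G ^^ r) d = (first_dart G ^^ r) d'"
    unfolding same_gate_iff by blast
  then have "(first_dart G ^^ r) (first_dart G d) = (first_dart G ^^ r) (first_dart G d')"
    using first_dart_funpow_mono[of r d d' "Suc r"] by (simp add: funpow_Suc_right del: funpow.simps)
  then show "same_gate G (first_dart G d) (first_dart G d')"
    using assms unfolding same_gate_iff by (auto simp: base_first_dart)
qed

definition gate :: "'e dart \<Rightarrow> 'e gate" where
  "gate d = {d'. same_gate G d d'}"

lemma mem_gate: "d \<in> gate d"
  by (simp add: gate_def same_gate_refl)

lemma gate_eq_iff: "gate d = gate d' \<longleftrightarrow> same_gate G d d'"
  using same_gate_refl same_gate_sym same_gate_trans unfolding gate_def by blast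

lemma gates_at_eq: "gates_at G v = gate ` {d. base G d = v}"
  unfolding gates_at_def gate_def by blast

lemma gate_in_gates_at_iff: "gate d \<in> gates_at G v \<longleftrightarrow> base G d = v"
  unfolding gates_at_eq by (auto simp: gate_eq_iff dest: same_gate_base)

lemma gates_atE:
  assumes "g \<in> gates_at G v"
  obtains d where "g = gate d" "base G d = v"
  using assms unfolding gates_at_eq by blast

lemma mem_gates_at: "g \<in> gates_at G v \<Longrightarrow> d \<in> g \<longleftrightarrow> g = gate d"
  by (metis gates_atE gate_def gate_eq_iff mem_Collect_eq)

lemma gates_at_unique: "g \<in> gates_at G v \<Longrightarrow> g \<in> gates_at G u \<Longrightarrow> u = v"
  by (metis gates_atE gate_in_gates_at_iff)

lemma infinitesimal_edges_eq:
  "B \<in> infinitesimal_edges G v \<longleftrightarrow>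
     (\<exists>d d'. B = {gate d, gate d'} \<and> base G d = v \<and> base G d' = v \<and> gate d \<noteq> gate d' \<and>
        (\<exists>r>0. \<exists>e. takes_turn (iterate G r (e, True)) d d'))" (is "_ \<longleftrightarrow> ?R")
proof
  assume "B \<in> infinitesimal_edges G v"
  then obtain a b r e d d' where ab: "B = {a, b}" "a \<in> gates_at G v" "b \<in> gates_at G v" "a \<noteq> b"
    and turn: "r > 0" "takes_turn (iterate G r (e, True)) d d'" and d: "d \<in> a" "d' \<in> b"
    unfolding infinitesimal_edges_def by blast
  moreover have "a = gate d" "b = gate d'"
    using ab d mem_gates_at by blast+
  moreover have "base G d = v" "base G d' = v"
    using calculation gate_in_gates_at_iff by auto
  ultimately show ?R by blast
next
  assume ?R
  then obtain d d' where "B = {gate d, gate d'}" "gate d \<in> gates_at G v" "gate d' \<in> gates_at G v"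
    "gate d \<noteq> gate d'" and turn: "\<exists>r>0. \<exists>e. takes_turn (iterate G r (e, True)) d d'"
    by (metis gate_in_gates_at_iff)
  moreover have "\<exists>r>0. \<exists>e. \<exists>c\<in>gate d. \<exists>c'\<in>gate d'. takes_turn (iterate G r (e, True)) c c'"
    using turn mem_gate by meson
  ultimately show "B \<in> infinitesimal_edges G v"
    unfolding infinitesimal_edges_def
    by (intro CollectI exI[of _ "gate d"] exI[of _ "gate d'"] conjI)
qed

lemma infinitesimal_edge_gates: "B \<in> infinitesimal_edges G v \<Longrightarrow> B \<subseteq> gates_at G v"
  by (auto simp: infinitesimal_edges_eq gate_in_gates_at_iff)

text \<open>
  If a turn taken by some iterate had both edge-ends in one gate, a further iterate would identify
  their images, and the edge-path would backtrack there.
\<close>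

lemma takes_turn_gates_neq:
  assumes turn: "takes_turn (iterate G r (e, True)) d d'"
  shows "gate d \<noteq> gate d'"
proof
  assume "gate d = gate d'"
  then obtain k where k: "k > 0" "hd (iterate G k d) = hd (iterate G k d')"
    unfolding gate_eq_iff same_gate_def by blast
  obtain p q where eq: "iterate G r (e, True) = p @ [flip d] @ [d'] @ q"
    using turn by (auto simp: takes_turn_def)
  have "iterate G (k + r) (e, True) = (path_image_map G ^^ k) p @ iterate G k (flip d) @
     iterate G k d' @ (path_image_map G ^^ k) q"
    by (simp only: iterate_add eq path_image_map_funpow_append iterate_def[symmetric])
  moreover have "last (iterate G k (flip d)) = flip (hd (iterate G k d))"
    by (simp add: iterate_flip last_rev hd_map iterate_nonempty)
  then have "\<not> no_backtracking (iterate G k (flip d) @ iterate G k d')"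
    using k by (auto simp: no_backtracking_def successively_append_iff iterate_nonempty)
  ultimately have "\<not> no_backtracking (iterate G (k + r) (e, True))"
    by (auto simp: no_backtracking_def successively_append_iff)
  moreover have "no_backtracking (iterate G (k + r) (e, True))"
    using train_track k(1) unfolding train_track_map_def by simp
  ultimately show False by simp
qed

text \<open>
  If \<open>f\<^sup>r(e)\<close> takes a turn, then \<open>f\<^sup>r\<^sup>+\<^sup>1(e)\<close> takes the image of the turn; its gates stay different because the
  map on the gates at a vertex is injective.
\<close>

lemma infinitesimal_edge_image:
  assumes "{gate d, gate d'} \<in> infinitesimal_edges G v" 
  shows "{gate (first_dart G d), gate (first_dart G d')} \<in> infinitesimal_edges G (vmap G v)"
proof -
  obtain c c' r e where c: "{gate d, gate d'} = {gate c, gate c'}" "base G c = v" "base G c' = v" "gate c \<noteq> gate c'"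
    and r: "takes_turn (iterate G r (e, True)) c c'"
    using assms unfolding infinitesimal_edges_eq by blast
  let ?D = "first_dart G"
  have gate_D: "gate (?D x) = gate (?D y)" if "gate x = gate y" for x y
    using that by (simp add: gate_eq_iff same_gate_first_dart same_gate_base)
  have "{gate (?D d), gate (?D d')} = {gate (?D c), gate (?D c')}"
    using c(1) gate_D[of d c] gate_D[of d' c'] gate_D[of d c'] gate_D[of d' c]
    by (metis doubleton_eq_iff)
  moreover have "base G (?D c) = vmap G v" "base G (?D c') = vmap G v"
    using c by (simp_all add: base_first_dart)
  moreover have "gate (?D c) \<noteq> gate (?D c')"
    using c by (simp add: gate_eq_iff same_gate_first_dart)
  moreover have "takes_turn (iterate G (Suc r) (e, True)) (?D c) (?D c')"
  proof -
    obtain p q where "iterate G r (e, True) = p @ flip c # c' # q"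
      using r by (auto simp: takes_turn_def)
    then have "iterate G (Suc r) (e, True) =
        path_image_map G p @ dart_image G (flip c) @ dart_image G c' @ path_image_map G q"
      by (simp add: iterate_Suc path_image_map_def)
    \<comment> \<open>the turn of the image is formed by the last dart of one image path and the first dart of the next\<close>
    moreover obtain p' where "dart_image G (flip c) = p' @ [flip (?D c)]"
      using dart_image_nonempty
      by (metis append_butlast_last_id dart_image_flip hd_map last_rev map_is_Nil_conv rev_is_Nil_conv)
    moreover obtain q' where "dart_image G c' = ?D c' # q'"
      using dart_image_nonempty by (metis list.collapse)
    ultimately have "iterate G (Suc r) (e, True) =
        (path_image_map G p @ p') @ [flip (?D c), ?D c'] @ (q' @ path_image_map G q)"
      by simp
    then show ?thesis
      unfolding takes_turn_def by blast
  qed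
  ultimately show ?thesis
    unfolding infinitesimal_edges_eq by blast
qed

definition alternating_at :: "'v \<Rightarrow> ('e gate \<Rightarrow> real) \<Rightarrow> bool" where
  "alternating_at v \<sigma> \<longleftrightarrow> (\<forall>B\<in>infinitesimal_edges G v. (\<Sum>g\<in>B. \<sigma> g) = 0)"

definition alternating :: "('e gate \<Rightarrow> real) \<Rightarrow> bool" where
  "alternating \<sigma> \<longleftrightarrow> (\<forall>v. alternating_at v \<sigma>)"

text \<open>
  The linear form on \<open>V(G)\<close> given by a function on gates.
\<close>

definition pairing :: "('e gate \<Rightarrow> real) \<Rightarrow> real^'e \<Rightarrow> real" where
  "pairing \<sigma> \<eta> = (\<Sum>d\<in>UNIV. \<sigma> (gate d) * vec_nth \<eta> (fst d))"

text \<open>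
  The choice of \<open>d\<close> in the gate is immaterial, by \<open>same_gate_first_dart\<close>.
\<close>

definition pullback :: "('e gate \<Rightarrow> real) \<Rightarrow> 'e gate \<Rightarrow> real" where
  "pullback \<sigma> g = \<sigma> (gate (first_dart G (SOME d. g = gate d)))"

lemma pullback_gate: "pullback \<sigma> (gate d) = \<sigma> (gate (first_dart G d))"
proof -
  have "gate d = gate (SOME c. gate d = gate c)"
    by (rule someI[of "\<lambda>c. gate d = gate c"]) simp
  then have "gate (first_dart G d) = gate (first_dart G (SOME c. gate d = gate c))"
    by (simp add: gate_eq_iff same_gate_first_dart same_gate_base)
  then show ?thesis
    by (simp add: pullback_def)
qed

lemma alternating_pair:
  assumes "alternating \<sigma>" "{gate d, gate d'} \<in> infinitesimal_edges G v" "gate d \<noteq> gate d'"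
  shows "\<sigma> (gate d) + \<sigma> (gate d') = 0"
proof -
  have "sum \<sigma> {gate d, gate d'} = 0"
    using assms(1,2) unfolding alternating_def alternating_at_def by blast
  then show ?thesis
    using assms(3) by simp
qed

lemma alternating_pullback:
  assumes "alternating \<sigma>"
  shows "alternating (pullback \<sigma>)"
  unfolding alternating_def alternating_at_def
proof clarify
  fix v B assume B: "B \<in> infinitesimal_edges G v"
  then obtain d d' where d: "B = {gate d, gate d'}" "gate d \<noteq> gate d'" "base G d = base G d'"
    unfolding infinitesimal_edges_eq by metis
  have "gate (first_dart G d) \<noteq> gate (first_dart G d')"
    using d by (simp add: gate_eq_iff same_gate_first_dart)
  moreover have "{gate (first_dart G d), gate (first_dart G d')} \<in> infinitesimal_edges G (vmap G v)"
    using B d by (intro infinitesimal_edge_image) simp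
  ultimately show "sum (pullback \<sigma>) B = 0"
    using d alternating_pair[OF assms] by (simp add: pullback_gate)
qed

text \<open>
  The turns of \<open>f(e)\<close> are infinitesimal edges.
\<close>

lemma alternating_along_edge_image:
  assumes "alternating \<sigma>"
  shows "successively (\<lambda>x y. \<sigma> (gate (flip x)) + \<sigma> (gate y) = 0) (emap G e)"
  unfolding successively_conv_nth
proof (intro allI impI)
  fix i assume i: "Suc i < length (emap G e)"
  let ?x = "emap G e ! i" and ?y = "emap G e ! Suc i"
  have "emap G e = take i (emap G e) @ ?x # ?y # drop (Suc (Suc i)) (emap G e)"
    using i by (metis Cons_nth_drop_Suc Suc_lessD append_take_drop_id)
  then have turn: "takes_turn (iterate G (Suc 0) (e, True)) (flip ?x) ?y"
    unfolding takes_turn_def iterate_1 by (metis append_Cons append_Nil dart_image.simps flip_flip)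
  have "base G ?y = base G (flip ?x)"
    using train_track i unfolding train_track_map_def by (auto simp: successively_conv_nth)
  then have "{gate (flip ?x), gate ?y} \<in> infinitesimal_edges G (base G ?y)"
    using turn takes_turn_gates_neq[OF turn] unfolding infinitesimal_edges_eq by (metis zero_less_Suc)
  then show "\<sigma> (gate (flip ?x)) + \<sigma> (gate ?y) = 0"
    using alternating_pair[OF assms] takes_turn_gates_neq[OF turn] by blast
qed

text \<open>
  Duality between \<open>f\<^sub>*\<close> and the pullback of alternating functions. Each passage of \<open>f(e\<^sub>j)\<close> over an
  edge contributes the values of \<open>\<sigma>\<close> at both ends of that edge. Summed along the path, these
  values cancel at the turns, and the values at the two ends of the path are those of the pullback
  at the two ends of \<open>e\<^sub>j\<close>.
\<close>

lemma pairing_fstar: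
  assumes "alternating \<sigma>"
  shows "pairing \<sigma> (fstar G \<eta>) = pairing (pullback \<sigma>) \<eta>"
proof -
  let ?s = "\<lambda>d. \<sigma> (gate d)"
  have "pairing \<sigma> (fstar G \<eta>) = (\<Sum>i\<in>UNIV. (?s (i, True) + ?s (i, False)) *
      (\<Sum>j\<in>UNIV. real (count_list (map fst (emap G j)) i) * vec_nth \<eta> j))"
    by (simp add: pairing_def sum_darts fstar_def transition_matrix_def matrix_vector_mult_def algebra_simps)
  also have "\<dots> = (\<Sum>j\<in>UNIV. vec_nth \<eta> j *
      (\<Sum>i\<in>UNIV. real (count_list (map fst (emap G j)) i) * (?s (i, True) + ?s (i, False))))"
    unfolding sum_distrib_left by (subst sum.swap) (simp add: mult_ac)
  also have "\<dots> = (\<Sum>j\<in>UNIV. vec_nth \<eta> j * (pullback \<sigma> (gate (j, True)) + pullback \<sigma> (gate (j, False))))"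
  proof (rule sum.cong[OF refl])
    fix j
    have ne: "emap G j \<noteq> []"
      using dart_image_nonempty[of "(j, True)"] by simp
    have "(\<Sum>i\<in>UNIV. real (count_list (map fst (emap G j)) i) * (?s (i, True) + ?s (i, False))) =
        (\<Sum>i\<leftarrow>map fst (emap G j). ?s (i, True) + ?s (i, False))"
      by (rule sum_list_eq_sum_count[symmetric])
    also have "\<dots> = (\<Sum>d\<leftarrow>emap G j. ?s d + ?s (flip d))"
    proof -
      have "?s (fst d, True) + ?s (fst d, False) = ?s d + ?s (flip d)" for d
        by (cases d; cases "snd d") auto
      then show ?thesis
        by (simp add: o_def)
    qed
    also have "\<dots> = ?s (hd (emap G j)) + ?s (flip (last (emap G j)))"
      by (rule sum_over_path[OF ne alternating_along_edge_image[OF assms]])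
    also have "\<dots> = pullback \<sigma> (gate (j, True)) + pullback \<sigma> (gate (j, False))"
      using ne by (simp add: pullback_gate hd_rev last_map)
    finally show "vec_nth \<eta> j * (\<Sum>i\<in>UNIV. real (count_list (map fst (emap G j)) i) *
        (?s (i, True) + ?s (i, False))) =
      vec_nth \<eta> j * (pullback \<sigma> (gate (j, True)) + pullback \<sigma> (gate (j, False)))"
      by simp
  qed
  also have "\<dots> = pairing (pullback \<sigma>) \<eta>"
    by (simp add: pairing_def sum_darts algebra_simps)
  finally show ?thesis .
qed

section \<open>Weights carried by the train track\<close>

lemma pairing_by_vertices:
  "pairing \<sigma> \<eta> = (\<Sum>v\<in>UNIV. \<Sum>g\<in>gates_at G v. \<sigma> g * gate_weight \<eta> g)"
proof -
  let ?h = "\<lambda>d. \<sigma> (gate d) * vec_nth \<eta> (fst d)"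
  have "(\<Sum>d | base G d = v. ?h d) = (\<Sum>g\<in>gates_at G v. \<sigma> g * gate_weight \<eta> g)" for v
  proof -
    have "(\<Sum>d | base G d = v. ?h d) = (\<Sum>g\<in>gates_at G v. \<Sum>d\<in>{d \<in> {d. base G d = v}. gate d = g}. ?h d)"
      by (rule sum.group[symmetric]) (auto simp: gate_in_gates_at_iff)
    also have "\<dots> = (\<Sum>g\<in>gates_at G v. \<sigma> g * gate_weight \<eta> g)"
    proof (rule sum.cong[OF refl])
      fix g assume g: "g \<in> gates_at G v"
      have "{d \<in> {d. base G d = v}. gate d = g} = g"
        using g mem_gates_at gate_in_gates_at_iff by auto
      moreover have "(\<Sum>d\<in>g. ?h d) = (\<Sum>d\<in>g. \<sigma> g * vec_nth \<eta> (fst d))"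
        using mem_gates_at[OF g] by (intro sum.cong) auto
      ultimately show "(\<Sum>d\<in>{d \<in> {d. base G d = v}. gate d = g}. ?h d) = \<sigma> g * gate_weight \<eta> g"
        by (simp add: gate_weight_def sum_distrib_left)
    qed
    finally show ?thesis .
  qed
  moreover have "pairing \<sigma> \<eta> = (\<Sum>v\<in>UNIV. \<Sum>d | base G d = v. ?h d)"
    unfolding pairing_def using sum.group[of UNIV UNIV "base G" ?h] by simp
  ultimately show ?thesis by simp
qed

text \<open>
  By the switch conditions, the form of \<open>\<sigma>\<close> on \<open>\<eta>\<close> equals the sum over the infinitesimal edges \<open>B\<close> of the
  weight of \<open>B\<close> times the sum of \<open>\<sigma>\<close> over the two gates of \<open>B\<close>.
\<close>

lemma W_graph_pairing_zero:
  assumes "\<eta> \<in> W_graph G" "alternating \<sigma>"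
  shows "pairing \<sigma> \<eta> = 0"
proof -
  obtain w where w: "w \<in> W_tau G" "\<eta> = collapse w"
    using assms(1) unfolding W_graph_def by blast
  have "(\<Sum>g\<in>gates_at G v. \<sigma> g * gate_weight \<eta> g) = 0" for v
  proof -
    let ?E = "infinitesimal_edges G v"
    have "(\<Sum>g\<in>gates_at G v. \<sigma> g * gate_weight \<eta> g) =
        (\<Sum>g\<in>gates_at G v. \<sigma> g * (\<Sum>B | B \<in> ?E \<and> g \<in> B. w (Infinitesimal B)))"
      using w by (intro sum.cong) (auto simp: W_tau_def gate_weight_def collapse_def)
    also have "\<dots> = (\<Sum>B\<in>?E. \<Sum>g | g \<in> gates_at G v \<and> g \<in> B. \<sigma> g * w (Infinitesimal B))"
      unfolding sum_distrib_left by (rule sum.swap_restrict) auto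
    also have "\<dots> = (\<Sum>B\<in>?E. w (Infinitesimal B) * (\<Sum>g\<in>B. \<sigma> g))"
    proof (rule sum.cong[OF refl])
      fix B assume "B \<in> ?E"
      then have "{g. g \<in> gates_at G v \<and> g \<in> B} = B"
        using infinitesimal_edge_gates by blast
      then show "(\<Sum>g | g \<in> gates_at G v \<and> g \<in> B. \<sigma> g * w (Infinitesimal B)) =
          w (Infinitesimal B) * (\<Sum>g\<in>B. \<sigma> g)"
        by (simp add: sum_distrib_right mult.commute[of "w (Infinitesimal B)" "sum \<sigma> B"])
    qed
    also have "\<dots> = 0"
      using assms(2) by (simp add: alternating_def alternating_at_def)
    finally show ?thesis .
  qed
  then show ?thesis
    by (simp add: pairing_by_vertices)
qed

text \<open>
  The switch conditions are a linear system for the infinitesimal weights, with the gate weights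
  \<open>\<gamma>\<close> of \<open>\<eta>\<close> as right hand side. The alternating functions are the solutions of the transposed
  homogeneous system, and a right hand side orthogonal to them is attained.
\<close>

lemma pairing_zero_imp_W_graph:
  assumes zero: "\<And>\<sigma>. alternating \<sigma> \<Longrightarrow> pairing \<sigma> \<eta> = 0"
  shows "\<eta> \<in> W_graph G"
proof -
  define E where "E = (\<Union>v. infinitesimal_edges G v)"
  define ind :: "'e gate set \<Rightarrow> real^('e gate)" where
    "ind B = vec_lambda (\<lambda>g. if g \<in> B then 1 else 0)" for B
  define \<gamma> :: "real^('e gate)" where
    "\<gamma> = vec_lambda (\<lambda>g. if g \<in> range gate then gate_weight \<eta> g else 0)"
  have inner_ind: "inner (ind B) y = (\<Sum>g\<in>B. vec_nth y g)" for B y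
  proof -
    have "inner (ind B) y = (\<Sum>g\<in>UNIV. if g \<in> B then vec_nth y g else 0)"
      unfolding inner_vec_def ind_def by (rule sum.cong) auto
    then show ?thesis
      by (simp add: sum.If_cases)
  qed
  have range_gate: "range gate = (\<Union>v. gates_at G v)"
    by (auto simp: gates_at_eq)
  have inner_\<gamma>: "inner \<gamma> y = pairing (vec_nth y) \<eta>" for y
  proof -
    have "inner \<gamma> y = (\<Sum>g\<in>UNIV. if g \<in> range gate then vec_nth y g * gate_weight \<eta> g else 0)"
      unfolding inner_vec_def \<gamma>_def by (rule sum.cong) auto
    also have "\<dots> = (\<Sum>g\<in>range gate. vec_nth y g * gate_weight \<eta> g)"
      by (subst sum.If_cases) auto
    also have "\<dots> = (\<Sum>v\<in>UNIV. \<Sum>g\<in>gates_at G v. vec_nth y g * gate_weight \<eta> g)"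
      unfolding range_gate by (rule sum.UNION_disjoint) (auto dest: gates_at_unique)
    finally show ?thesis
      by (simp add: pairing_by_vertices)
  qed
  \<comment> \<open>the vectors orthogonal to all indicators of infinitesimal edges are the alternating functions\<close>
  have "\<gamma> \<in> (orthogonal_comp (orthogonal_comp (span (ind ` E))))"
    unfolding orthogonal_comp_def[of "orthogonal_comp _"]
  proof clarify
    fix y assume "y \<in> orthogonal_comp (span (ind ` E))"
    then have "inner (ind B) y = 0" if "B \<in> E" for B
      using that by (simp add: orthogonal_comp_def real_inner_class.orthogonal_def span_base)
    then have "alternating (vec_nth y)"
      unfolding alternating_def alternating_at_def E_def inner_ind by blast
    then show "real_inner_class.orthogonal y \<gamma>"
      using zero[of "vec_nth y"] inner_\<gamma>[of y] by (simp add: real_inner_class.orthogonal_def inner_commute[of y])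
  qed
  then have "\<gamma> \<in> span (ind ` E)"
    by (simp add: orthogonal_comp_self)
  then obtain c where c: "\<gamma> = (\<Sum>x\<in>ind ` E. c x *\<^sub>R x)"
    by (auto simp: span_finite)
  have inj: "inj ind"
  proof
    fix B B' assume "ind B = ind B'"
    then have "vec_nth (ind B) g = vec_nth (ind B') g" for g
      by simp
    then have "(if g \<in> B then 1 else 0 :: real) = (if g \<in> B' then 1 else 0)" for g
      by (simp add: ind_def)
    then have "(g \<in> B) = (g \<in> B')" for g
      by (metis zero_neq_one)
    then show "B = B'" by blast
  qed
  have \<gamma>: "vec_nth \<gamma> g = (\<Sum>B | B \<in> E \<and> g \<in> B. c (ind B))" for g
  proof -
    have "\<gamma> = (\<Sum>B\<in>E. c (ind B) *\<^sub>R ind B)"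
      unfolding c using inj by (simp add: sum.reindex inj_on_subset[OF inj] o_def)
    then have "vec_nth \<gamma> g = (\<Sum>B\<in>E. c (ind B) * vec_nth (ind B) g)"
      by simp
    also have "\<dots> = (\<Sum>B\<in>E. if g \<in> B then c (ind B) else 0)"
      by (rule sum.cong) (auto simp: ind_def)
    also have "\<dots> = (\<Sum>B | B \<in> E \<and> g \<in> B. c (ind B))"
      by (simp add: sum.inter_filter)
    finally show ?thesis .
  qed
  define w where "w b = (case b of Real_edge e \<Rightarrow> vec_nth \<eta> e
      | Infinitesimal B \<Rightarrow> if B \<in> E then c (ind B) else 0)" for b
  have "w \<in> W_tau G"
    unfolding W_tau_def
  proof (intro CollectI conjI allI impI ballI)
    fix B assume "\<forall>v. B \<notin> infinitesimal_edges G v"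
    then show "w (Infinitesimal B) = 0"
      by (simp add: w_def E_def)
  next
    fix v g assume g: "g \<in> gates_at G v"
    have "{B. B \<in> infinitesimal_edges G v \<and> g \<in> B} = {B. B \<in> E \<and> g \<in> B}"
      using g infinitesimal_edge_gates gates_at_unique unfolding E_def by blast
    moreover have "vec_nth \<gamma> g = gate_weight \<eta> g"
      using g range_gate by (auto simp: \<gamma>_def)
    ultimately show "(\<Sum>d\<in>g. w (Real_edge (fst d))) =
        (\<Sum>B | B \<in> infinitesimal_edges G v \<and> g \<in> B. w (Infinitesimal B))"
      using \<gamma>[of g] by (simp add: w_def gate_weight_def)
  qed
  moreover have "collapse w = \<eta>"
    by (simp add: collapse_def w_def Finite_Cartesian_Product.vec_eq_iff)
  ultimately show ?thesis
    unfolding W_graph_def by blast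
qed

lemma fstar_W_graph:
  assumes "\<eta> \<in> W_graph G"
  shows "fstar G \<eta> \<in> W_graph G"
proof -
  have "pairing \<sigma> (fstar G \<eta>) = 0" if "alternating \<sigma>" for \<sigma>
    unfolding pairing_fstar[OF that] by (rule W_graph_pairing_zero[OF assms alternating_pullback[OF that]])
  then show ?thesis
    by (rule pairing_zero_imp_W_graph)
qed

section \<open>Alternating functions at a vertex\<close>

text \<open>
  What complete and partial polygons have in common: consecutive gates are joined.
\<close>

definition chain_numbering :: "'v \<Rightarrow> (nat \<Rightarrow> 'e gate) \<Rightarrow> bool" where
  "chain_numbering v g \<longleftrightarrow> bij_betw g {..<card (gates_at G v)} (gates_at G v) \<and>
     (\<forall>i. Suc i < card (gates_at G v) \<longrightarrow> {g i, g (Suc i)} \<in> infinitesimal_edges G v)"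

lemma complete_numbering_chain:
  assumes "complete_numbering S G v g"
  shows "chain_numbering v g"
proof -
  let ?k = "card (gates_at G v)"
  have edges: "infinitesimal_edges G v = {{g i, g (Suc i mod ?k)} |i. i < ?k}"
    using assms by (simp add: complete_numbering_def)
  have "{g i, g (Suc i)} \<in> infinitesimal_edges G v" if "Suc i < ?k" for i
    unfolding edges using that by (intro CollectI exI[of _ i]) simp
  then show ?thesis
    using assms by (simp add: complete_numbering_def cyclic_numbering_def chain_numbering_def)
qed

lemma partial_numbering_chain:
  assumes "partial_numbering S G v g"
  shows "chain_numbering v g"
  using assms by (auto simp: partial_numbering_def cyclic_numbering_def chain_numbering_def)

lemma chain_numbering_alternating:
  assumes "chain_numbering v g" "alternating_at v \<sigma>" "i < card (gates_at G v)"
  shows "\<sigma> (g i) = (-1) ^ i * \<sigma> (g 0)"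
  using assms(3)
proof (induction i)
  case (Suc i)
  have "g i \<noteq> g (Suc i)"
    using Suc(2) assms(1) unfolding chain_numbering_def bij_betw_def by (auto dest: inj_onD)
  moreover have "(\<Sum>x\<in>{g i, g (Suc i)}. \<sigma> x) = 0"
    using Suc(2) assms(1,2) unfolding chain_numbering_def alternating_at_def by blast
  ultimately show ?case
    using Suc by simp
qed simp

text \<open>
  Going once around an odd polygon reverses the sign of \<open>\<sigma>\<close>.
\<close>

lemma alternating_at_odd_vertex:
  assumes "odd_vertex S G v" "alternating_at v \<sigma>" "x \<in> gates_at G v"
  shows "\<sigma> x = 0"
proof -
  let ?k = "card (gates_at G v)"
  obtain g where g: "complete_numbering S G v g" and odd: "odd ?k"
    using assms(1) unfolding odd_vertex_def by blast
  note chain = complete_numbering_chain[OF g]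
  have k: "3 \<le> ?k"
    using g unfolding complete_numbering_def by blast
  have "{g (?k - 1), g (Suc (?k - 1) mod ?k)} \<in> infinitesimal_edges G v"
    using g k unfolding complete_numbering_def by (auto intro!: exI[of _ "?k - 1"])
  then have "(\<Sum>y\<in>{g (?k - 1), g 0}. \<sigma> y) = 0"
    using k assms(2) unfolding alternating_at_def by simp
  moreover have "g (?k - 1) \<noteq> g 0"
  proof
    assume "g (?k - 1) = g 0"
    moreover have "inj_on g {..<?k}"
      using chain unfolding chain_numbering_def bij_betw_def by blast
    ultimately have "?k - 1 = 0"
      using k inj_onD[of g "{..<?k}" "?k - 1" 0] by simp
    then show False using k by simp
  qed
  moreover have "\<sigma> (g (?k - 1)) = \<sigma> (g 0)"
    using chain_numbering_alternating[OF chain assms(2), of "?k - 1"] k odd by simp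
  ultimately have "\<sigma> (g 0) = 0"
    by simp
  moreover obtain i where "i < ?k" "x = g i"
    using assms(3) chain unfolding chain_numbering_def bij_betw_def by blast
  ultimately show ?thesis
    using chain_numbering_alternating[OF chain assms(2), of i] by simp
qed

lemma alternating_at_proportional:
  assumes "chain_numbering v g" "alternating_at v \<sigma>" "alternating_at v s"
    and "\<And>x. x \<in> gates_at G v \<Longrightarrow> \<bar>s x\<bar> = 1"
  obtains c where "\<And>x. x \<in> gates_at G v \<Longrightarrow> \<sigma> x = c * s x"
proof
  fix x assume "x \<in> gates_at G v"
  then obtain i where i: "i < card (gates_at G v)" "x = g i"
    using assms(1) unfolding chain_numbering_def bij_betw_def by blast
  have "g 0 \<in> gates_at G v"
    using assms(1) i unfolding chain_numbering_def bij_betw_def by auto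
  then have "s (g 0) * s (g 0) = 1"
    using assms(4) by (metis abs_mult_self_eq mult_1)
  then show "\<sigma> x = (\<sigma> (g 0) * s (g 0)) * s x"
    using chain_numbering_alternating[OF assms(1,2) i(1)] chain_numbering_alternating[OF assms(1,3) i(1)] i
    by simp
qed

lemma alternating_at_even_or_partial:
  assumes g: "complete_numbering S G v g \<and> even (card (gates_at G v)) \<or> partial_numbering S G v g"
    and s: "\<And>i. i < card (gates_at G v) \<Longrightarrow> s (g i) = \<epsilon> * (-1) ^ i"
  shows "alternating_at v s"
  unfolding alternating_at_def
proof
  let ?k = "card (gates_at G v)"
  have inj: "inj_on g {..<?k}"
    using g unfolding complete_numbering_def partial_numbering_def cyclic_numbering_def bij_betw_def by blast
  fix B assume B: "B \<in> infinitesimal_edges G v"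
  then have "\<exists>i j. B = {g i, g j} \<and> i < ?k \<and> j < ?k \<and> i \<noteq> j \<and> ((-1) ^ j :: real) = - ((-1) ^ i)"
    using g
  proof (elim disjE conjE)
    assume c: "complete_numbering S G v g" and even: "even ?k"
    then obtain i where i: "i < ?k" "B = {g i, g (Suc i mod ?k)}"
      using B unfolding complete_numbering_def by auto
    have k: "3 \<le> ?k"
      using c unfolding complete_numbering_def by blast
    show ?thesis
    proof (cases "Suc i = ?k")
      case True
      then have "odd i"
        using even by (metis even_Suc)
      then show ?thesis
        using i True k by (intro exI[of _ i] exI[of _ 0]) auto
    next
      case False
      then show ?thesis
        using i by (intro exI[of _ i] exI[of _ "Suc i"]) auto
    qed
  next
    assume "partial_numbering S G v g"
    then obtain i where "Suc i < ?k" "B = {g i, g (Suc i)}"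
      using B unfolding partial_numbering_def by auto
    then show ?thesis
      by (intro exI[of _ i] exI[of _ "Suc i"]) auto
  qed
  then obtain i j where ij: "B = {g i, g j}" "i < ?k" "j < ?k" "i \<noteq> j" "((-1) ^ j :: real) = - ((-1) ^ i)"
    by blast
  then have "g i \<noteq> g j"
    using inj by (auto dest: inj_onD)
  then show "sum s B = 0"
    using ij s by simp
qed

text \<open>
  The notions are defined by the existence of numberings, so that their exclusiveness needs an
  argument: an odd polygon carries no nonzero alternating function.
\<close>

lemma odd_not_non_odd:
  assumes "odd_vertex S G v"
  shows "\<not> non_odd_vertex S G v"
proof
  assume "non_odd_vertex S G v"
  then obtain g where g: "complete_numbering S G v g \<and> even (card (gates_at G v)) \<or> partial_numbering S G v g"
    unfolding non_odd_vertex_def even_vertex_def partial_vertex_def by blast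
  let ?k = "card (gates_at G v)"
  have bij: "bij_betw g {..<?k} (gates_at G v)"
    using g unfolding complete_numbering_def partial_numbering_def cyclic_numbering_def by blast
  \<comment> \<open>signs that alternate along the numbering do not vanish, which is impossible at an odd polygon\<close>
  define s :: "'e gate \<Rightarrow> real" where "s x = (-1) ^ the_inv_into {..<?k} g x" for x
  have "s (g i) = 1 * (-1) ^ i" if "i < ?k" for i
    using that bij unfolding s_def bij_betw_def by (simp add: the_inv_into_f_f)
  then have "alternating_at v s"
    by (rule alternating_at_even_or_partial[OF g])
  moreover have "3 \<le> ?k"
    using assms unfolding odd_vertex_def complete_numbering_def by blast
  then have "gates_at G v \<noteq> {}" by auto
  then obtain x where "x \<in> gates_at G v" by blast
  ultimately have "s x = 0"
    using alternating_at_odd_vertex[OF assms] by blast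
  then show False
    by (simp add: s_def)
qed

text \<open>
  In an orientation, an infinitesimal edge leaves the gate at one of its ends and enters the gate at
  the other, and the real edges continue these directions.
\<close>

lemma tau_orientation_signs:
  assumes or: "tau_orientation G \<omega> \<kappa>"
    and s: "\<And>v g d. g \<in> gates_at G v \<Longrightarrow> d \<in> g \<Longrightarrow> s g = (if towards \<omega> d then 1 else -1)"
  shows "alternating_at v s"
  unfolding alternating_at_def
proof
  fix B assume B: "B \<in> infinitesimal_edges G v"
  then obtain d d' where d: "B = {gate d, gate d'}" "gate d \<noteq> gate d'" "base G d = v" "base G d' = v"
    unfolding infinitesimal_edges_eq by metis
  have "\<kappa> B \<in> B"
    using or B unfolding tau_orientation_def by blast
  moreover have "s (gate c) = (if \<kappa> B = gate c then -1 else 1)" if "gate c \<in> B" "base G c = v" for c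
  proof -
    have gc: "gate c \<in> gates_at G v"
      using that by (simp add: gate_in_gates_at_iff)
    then have "(\<forall>x\<in>gate c. towards \<omega> x) \<and> (\<forall>B\<in>infinitesimal_edges G v. gate c \<in> B \<longrightarrow> \<kappa> B \<noteq> gate c) \<or>
        (\<forall>x\<in>gate c. \<not> towards \<omega> x) \<and> (\<forall>B\<in>infinitesimal_edges G v. gate c \<in> B \<longrightarrow> \<kappa> B = gate c)"
      using or unfolding tau_orientation_def by blast
    then have "towards \<omega> c \<longleftrightarrow> \<kappa> B \<noteq> gate c"
      using B that(1) mem_gate[of c] by metis
    then show ?thesis
      using s[OF gc mem_gate] by auto
  qed
  ultimately show "sum s B = 0"
    using d by auto
qed

end

section \<open>Kernel and rank of the map delta\<close>

text \<open>
  A train track map with admissible gate signs. The types of the vertices are taken with respect to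
  the surface \<open>S\<close>, and connectedness of the graph has the combinatorial form that functions invariant
  along the edges are constant.
\<close>

locale signed_train_track = train_track G
  for G :: "('s, 'v::finite, 'e::finite) graph_map" +
  fixes S :: "'s topology" and s :: "'e gate \<Rightarrow> real"
  assumes vertex_types: "odd_vertex S G v \<or> even_vertex S G v \<or> partial_vertex S G v"
    and signs: "gate_signs S G s"
    and graph_connected: "\<And>(c :: 'v \<Rightarrow> real) u v.
      (\<And>e. c (base G (e, True)) = c (base G (e, False))) \<Longrightarrow> c u = c v"
begin

lemma non_odd_iff: "non_odd_vertex S G v \<longleftrightarrow> \<not> odd_vertex S G v"
  using vertex_types[of v] odd_not_non_odd[of S v] by (auto simp: non_odd_vertex_def)

lemma ex_chain_numbering: "\<exists>g. chain_numbering v g"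
proof -
  obtain g where "complete_numbering S G v g \<or> partial_numbering S G v g"
    using vertex_types[of v] by (auto simp: odd_vertex_def even_vertex_def partial_vertex_def)
  then show ?thesis
    using complete_numbering_chain partial_numbering_chain by metis
qed

lemma orientable_signs:
  assumes "tau_orientable G"
  obtains \<omega> where "\<And>v g d. g \<in> gates_at G v \<Longrightarrow> d \<in> g \<Longrightarrow> s g = (if towards \<omega> d then 1 else -1)"
    and "\<And>v. alternating_at v s"
proof -
  obtain \<omega> \<kappa> where or: "tau_orientation G \<omega> \<kappa>"
    and s: "\<forall>v. \<forall>g\<in>gates_at G v. \<forall>d\<in>g. s g = (if towards \<omega> d then 1 else -1)"
    using signs assms unfolding gate_signs_def by auto
  show thesis
    by (rule that[of \<omega>, OF _ tau_orientation_signs[OF or]]) (use s in blast)+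
qed

lemma signs_at_non_odd:
  assumes "non_odd_vertex S G v"
  shows signs_alternating: "alternating_at v s"
    and signs_unit: "g \<in> gates_at G v \<Longrightarrow> \<bar>s g\<bar> = 1"
proof -
  have "alternating_at v s \<and> (\<forall>g\<in>gates_at G v. \<bar>s g\<bar> = 1)"
  proof (cases "tau_orientable G")
    case True
    then obtain \<omega> where s: "\<And>v g d. g \<in> gates_at G v \<Longrightarrow> d \<in> g \<Longrightarrow> s g = (if towards \<omega> d then 1 else -1)"
      and alt: "\<And>v. alternating_at v s"
      using orientable_signs by blast
    have "\<bar>s g\<bar> = 1" if g: "g \<in> gates_at G v" for g
    proof -
      obtain d where "g = gate d"
        using g by (rule gates_atE)
      then show ?thesis
        using s[OF g, of d] mem_gate[of d] by auto
    qed
    then show ?thesis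
      using alt by blast
  next
    case False
    let ?k = "card (gates_at G v)"
    obtain g \<epsilon> where g: "complete_numbering S G v g \<or> partial_numbering S G v g"
      and \<epsilon>: "\<epsilon> \<in> {1, -1::real}" and s: "\<And>i. i < ?k \<Longrightarrow> s (g i) = \<epsilon> * (-1) ^ i"
      using signs assms unfolding gate_signs_def if_not_P[OF False] by blast
    have "complete_numbering S G v g \<and> even ?k \<or> partial_numbering S G v g"
      using g assms non_odd_iff unfolding odd_vertex_def by blast
    then have "alternating_at v s"
      using s by (rule alternating_at_even_or_partial)
    moreover have "\<bar>s x\<bar> = 1" if x: "x \<in> gates_at G v" for x
    proof -
      have "bij_betw g {..<?k} (gates_at G v)"
        using g unfolding complete_numbering_def partial_numbering_def cyclic_numbering_def by blast
      then obtain i where "i < ?k" "x = g i"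
        using x unfolding bij_betw_def by blast
      then show ?thesis
        using s \<epsilon> by (auto simp: abs_mult power_abs)
    qed
    ultimately show ?thesis by blast
  qed
  then show "alternating_at v s" "g \<in> gates_at G v \<Longrightarrow> \<bar>s g\<bar> = 1"
    by blast+
qed

text \<open>
  The signs of an orientation alternate at every vertex and vanish nowhere.
\<close>

lemma orientable_imp_non_odd:
  assumes "tau_orientable G"
  shows "non_odd_vertex S G v"
proof (rule ccontr)
  assume "\<not> non_odd_vertex S G v"
  then have odd: "odd_vertex S G v"
    by (simp add: non_odd_iff)
  obtain \<omega> where s: "\<And>v g d. g \<in> gates_at G v \<Longrightarrow> d \<in> g \<Longrightarrow> s g = (if towards \<omega> d then 1 else -1)"
    and alt: "\<And>v. alternating_at v s"
    using orientable_signs[OF assms] by blast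
  have "3 \<le> card (gates_at G v)"
    using odd unfolding odd_vertex_def complete_numbering_def by blast
  then have "gates_at G v \<noteq> {}"
    by auto
  then obtain d where d: "gate d \<in> gates_at G v"
    by (metis all_not_in_conv gates_atE)
  then have "s (gate d) = 0"
    by (rule alternating_at_odd_vertex[OF odd alt])
  then show False
    using s[OF d mem_gate] by (auto split: if_splits)
qed

abbreviation \<delta> :: "real^'e \<Rightarrow> real^'v" where
  "\<delta> \<equiv> delta S G s"

text \<open>
  The alternating function with coefficient \<open>c v\<close> at each non-odd vertex \<open>v\<close>; the vertex of a gate
  is recovered from any of its edge-ends.
\<close>

definition weighted_signs :: "('v \<Rightarrow> real) \<Rightarrow> 'e gate \<Rightarrow> real" where
  "weighted_signs c g = (let v = base G (SOME d. g = gate d) in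
     if non_odd_vertex S G v then c v * s g else 0)"

lemma weighted_signs_gate:
  "g \<in> gates_at G v \<Longrightarrow> weighted_signs c g = (if non_odd_vertex S G v then c v * s g else 0)"
proof -
  assume g: "g \<in> gates_at G v"
  then have "g = gate (SOME d. g = gate d)"
    by (metis (mono_tags, lifting) gates_atE someI_ex)
  then have "base G (SOME d. g = gate d) = v"
    using g gate_in_gates_at_iff by metis
  then show ?thesis
    by (simp add: weighted_signs_def Let_def)
qed

lemma alternating_weighted_signs: "alternating (weighted_signs c)"
  unfolding alternating_def alternating_at_def
proof (intro allI ballI)
  fix v B assume B: "B \<in> infinitesimal_edges G v"
  have "sum (weighted_signs c) B = (\<Sum>g\<in>B. if non_odd_vertex S G v then c v * s g else 0)"
    using infinitesimal_edge_gates[OF B] by (intro sum.cong) (auto simp: weighted_signs_gate)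
  also have "\<dots> = 0"
  proof (cases "non_odd_vertex S G v")
    case True
    then have "sum s B = 0"
      using signs_alternating B by (simp add: alternating_at_def)
    then show ?thesis
      using True by (simp flip: sum_distrib_left)
  qed simp
  finally show "sum (weighted_signs c) B = 0" .
qed

text \<open>
  The coefficient at a non-odd vertex is the ratio of \<open>\<sigma>\<close> to the signs, which is constant along the chain
  of gates; at an odd vertex both sides vanish.
\<close>

lemma alternating_eq_weighted_signs:
  assumes "alternating \<sigma>"
  obtains c where "\<And>v g. g \<in> gates_at G v \<Longrightarrow> \<sigma> g = weighted_signs c g"
proof -
  have "\<exists>c. \<forall>g\<in>gates_at G v. \<sigma> g = (if non_odd_vertex S G v then c * s g else 0)" for v
  proof (cases "non_odd_vertex S G v")
    case True
    obtain h where "chain_numbering v h"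
      using ex_chain_numbering by blast
    moreover have "alternating_at v \<sigma>"
      using assms alternating_def by blast
    ultimately obtain c where "\<And>x. x \<in> gates_at G v \<Longrightarrow> \<sigma> x = c * s x"
      using alternating_at_proportional[OF _ _ signs_alternating[OF True] signs_unit[OF True]] by metis
    then show ?thesis
      using True by auto
  next
    case False
    then show ?thesis
      using assms alternating_def alternating_at_odd_vertex[of S v \<sigma>] non_odd_iff by auto
  qed
  then obtain c where "\<And>v g. g \<in> gates_at G v \<Longrightarrow> \<sigma> g = (if non_odd_vertex S G v then c v * s g else 0)"
    by metis
  then show thesis
    by (intro that[of c]) (simp add: weighted_signs_gate)
qed

text \<open>
  The linear form of \<open>c\<close> is the composition of \<open>\<delta>\<close> with the inner product by \<open>c\<close>. This makes statements about
  \<open>\<delta>\<close> available from statements about alternating functions.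
\<close>

lemma inner_delta: "inner (vec_lambda c) (\<delta> \<eta>) = pairing (weighted_signs c) \<eta>"
proof -
  have "c v * vec_nth (\<delta> \<eta>) v = (\<Sum>g\<in>gates_at G v. weighted_signs c g * gate_weight \<eta> g)" for v
  proof -
    have "(\<Sum>g\<in>gates_at G v. weighted_signs c g * gate_weight \<eta> g) =
        (\<Sum>g\<in>gates_at G v. if non_odd_vertex S G v then c v * (s g * gate_weight \<eta> g) else 0)"
      by (intro sum.cong) (auto simp: weighted_signs_gate)
    then show ?thesis
      by (auto simp: delta_def simp flip: sum_distrib_left)
  qed
  then show ?thesis
    by (simp add: inner_vec_def pairing_by_vertices)
qed

lemma linear_delta: "linear \<delta>"
proof (rule linearI)
  have "gate_weight (x + y) g = gate_weight x g + gate_weight y g"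
    "gate_weight (r *\<^sub>R x) g = r * gate_weight x g" for x y :: "real^'e" and r g
    by (simp_all add: gate_weight_def sum.distrib sum_distrib_left)
  then show "\<delta> (x + y) = \<delta> x + \<delta> y" "\<delta> (r *\<^sub>R x) = r *\<^sub>R \<delta> x" for x y r
    by (simp_all add: delta_def Finite_Cartesian_Product.vec_eq_iff sum.distrib sum_distrib_left algebra_simps)
qed

lemma kernel_delta: "{\<eta>. \<delta> \<eta> = 0} = W_graph G"
proof (intro subset_antisym subsetI)
  fix \<eta> assume "\<eta> \<in> {\<eta>. \<delta> \<eta> = 0}"
  then have zero: "pairing (weighted_signs c) \<eta> = 0" for c
    using inner_delta[of c \<eta>] by simp
  show "\<eta> \<in> W_graph G"
  proof (rule pairing_zero_imp_W_graph)
    fix \<sigma> assume "alternating \<sigma>"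
    then obtain c where "\<And>v g. g \<in> gates_at G v \<Longrightarrow> \<sigma> g = weighted_signs c g"
      using alternating_eq_weighted_signs by blast
    then have "pairing \<sigma> \<eta> = pairing (weighted_signs c) \<eta>"
      by (simp add: pairing_by_vertices)
    then show "pairing \<sigma> \<eta> = 0"
      by (simp add: zero)
  qed
next
  fix \<eta> assume "\<eta> \<in> W_graph G"
  then have "inner (vec_lambda c) (\<delta> \<eta>) = 0" for c
    unfolding inner_delta using alternating_weighted_signs by (rule W_graph_pairing_zero)
  then have "inner (\<delta> \<eta>) (\<delta> \<eta>) = 0"
    by (metis vec_nth_inverse)
  then show "\<eta> \<in> {\<eta>. \<delta> \<eta> = 0}"
    by simp
qed

text \<open>
  The equation of an edge \<open>e\<close> results from testing with the weight that is 1 on \<open>e\<close> and 0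
  elsewhere.
\<close>

lemma orthogonal_range_delta_iff:
  "(\<forall>y\<in>range \<delta>. real_inner_class.orthogonal y (vec_lambda c)) \<longleftrightarrow>
     (\<forall>e. weighted_signs c (gate (e, True)) + weighted_signs c (gate (e, False)) = 0)"
proof -
  have eq: "inner (\<delta> \<eta>) (vec_lambda c) =
      (\<Sum>e\<in>UNIV. vec_nth \<eta> e * (weighted_signs c (gate (e, True)) + weighted_signs c (gate (e, False))))" for \<eta>
    by (simp add: inner_commute[of "\<delta> \<eta>"] inner_delta pairing_def sum_darts algebra_simps)
  have "weighted_signs c (gate (e, True)) + weighted_signs c (gate (e, False)) = 0"
    if "\<forall>\<eta>. inner (\<delta> \<eta>) (vec_lambda c) = 0" for e
  proof -
    let ?b = "\<lambda>i. weighted_signs c (gate (i, True)) + weighted_signs c (gate (i, False))"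
    have "?b e = (\<Sum>i\<in>UNIV. if i = e then ?b i else 0)"
      by simp
    also have "\<dots> = (\<Sum>i\<in>UNIV. vec_nth (axis e 1) i * ?b i)"
      by (rule sum.cong) (auto simp: axis_def)
    also have "\<dots> = 0"
      using that eq by metis
    finally show ?thesis .
  qed
  moreover have "inner (\<delta> \<eta>) (vec_lambda c) = 0"
    if "\<forall>e. weighted_signs c (gate (e, True)) + weighted_signs c (gate (e, False)) = 0" for \<eta>
    unfolding eq using that by simp
  ultimately show ?thesis
    by (auto simp: real_inner_class.orthogonal_def)
qed

lemma dim_range_delta:
  "dim {c. \<forall>y\<in>range \<delta>. real_inner_class.orthogonal y c} + dim (range \<delta>) = CARD('v)"
proof -
  have "subspace (range \<delta>)"
    by (rule linear_subspace_image[OF linear_delta subspace_UNIV])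
  from dim_subspace_orthogonal_to_vectors[OF this subspace_UNIV subset_UNIV] show ?thesis
    by simp
qed

text \<open>
  The two ends of an edge have opposite signs, so that a vector orthogonal to the image takes equal
  values at both ends; by connectedness it is constant.
\<close>

lemma dim_range_delta_orientable:
  assumes "tau_orientable G"
  shows "dim (range \<delta>) + 1 = CARD('v)"
proof -
  obtain \<omega> where s: "\<And>v g d. g \<in> gates_at G v \<Longrightarrow> d \<in> g \<Longrightarrow> s g = (if towards \<omega> d then 1 else -1)"
    using orientable_signs[OF assms] by metis
  have s_gate: "s (gate d) = (if towards \<omega> d then 1 else -1)" for d
    using s[of "gate d" "base G d" d] by (simp add: gate_in_gates_at_iff mem_gate)
  have ws: "weighted_signs c (gate d) = c (base G d) * s (gate d)" for c d
    using weighted_signs_gate[of "gate d" "base G d" c] orientable_imp_non_odd[OF assms]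
    by (simp add: gate_in_gates_at_iff)
  have edge: "weighted_signs c (gate (e, True)) + weighted_signs c (gate (e, False)) = 0 \<longleftrightarrow>
      c (base G (e, True)) = c (base G (e, False))" for c e
    by (auto simp: ws s_gate towards_def)
  let ?K = "{c. \<forall>y\<in>range \<delta>. real_inner_class.orthogonal y c}"
  have "?K = span {vec_lambda (\<lambda>_. 1)}"
  proof (intro subset_antisym subsetI)
    fix c assume "c \<in> ?K"
    then have "\<forall>y\<in>range \<delta>. real_inner_class.orthogonal y (vec_lambda (vec_nth c))"
      by simp
    then have "vec_nth c (base G (e, True)) = vec_nth c (base G (e, False))" for e
      unfolding orthogonal_range_delta_iff edge by blast
    then have "vec_nth c u = vec_nth c undefined" for u
      by (rule graph_connected)
    then have "c = vec_nth c undefined *\<^sub>R vec_lambda (\<lambda>_. 1)"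
      by (simp add: Finite_Cartesian_Product.vec_eq_iff)
    then show "c \<in> span {vec_lambda (\<lambda>_. 1)}"
      by (metis insertI1 span_base span_scale)
  next
    fix c :: "real^'v" assume "c \<in> span {vec_lambda (\<lambda>_. 1)}"
    then obtain k where "c = vec_lambda (\<lambda>_. k)"
      by (auto simp: span_singleton Finite_Cartesian_Product.vec_eq_iff)
    then show "c \<in> ?K"
      using orthogonal_range_delta_iff[of "\<lambda>_. k"] edge[of "\<lambda>_. k"] by simp
  qed
  moreover have "vec_lambda (\<lambda>_. 1) \<noteq> (0 :: real^'v)"
    by (simp add: Finite_Cartesian_Product.vec_eq_iff)
  ultimately have "dim ?K = 1"
    by (simp add: dim_singleton)
  then show ?thesis
    using dim_range_delta by simp
qed

text \<open>
  The absolute value of \<open>c\<close>, set to zero at odd vertices, is constant along edges, hence nowhere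
  zero, and every vertex is non-odd. The real edges are directed towards the vertex at those edge-ends where the weighted sign
  is positive, which is consistent because the weighted signs at the two ends of an edge cancel. An
  infinitesimal edge points to its gate with negative weighted sign.
\<close>

lemma balanced_weights_imp_orientable:
  assumes balanced: "\<And>e. weighted_signs c (gate (e, True)) + weighted_signs c (gate (e, False)) = 0"
    and nonzero: "non_odd_vertex S G v" "c v \<noteq> 0"
  shows "tau_orientable G"
proof -
  \<comment> \<open>the absolute value of the weighted sign at the gates of a vertex, zero at odd vertices\<close>
  define b where "b v = (if non_odd_vertex S G v then \<bar>c v\<bar> else 0)" for v
  have abs_ws: "\<bar>weighted_signs c g\<bar> = b u" if "g \<in> gates_at G u" for g u
    using that signs_unit[of u g] by (auto simp: weighted_signs_gate b_def abs_mult)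
  have b_gate: "\<bar>weighted_signs c (gate d)\<bar> = b (base G d)" for d
    by (rule abs_ws) (simp add: gate_in_gates_at_iff)
  have "b (base G (e, True)) = b (base G (e, False))" for e
    using balanced[of e] by (simp add: eq_neg_iff_add_eq_0 flip: b_gate)
  then have "b u = b v" for u
    by (rule graph_connected)
  then have "b u \<noteq> 0" for u
    using nonzero by (simp add: b_def)
  then have ws_nz: "weighted_signs c g \<noteq> 0" if "g \<in> gates_at G u" for g u
    using abs_ws[OF that] by auto
  let ?t = "\<lambda>d. weighted_signs c (gate d)"
  define \<omega> where "\<omega> e \<longleftrightarrow> ?t (e, False) > 0" for e
  have t_nz: "?t d \<noteq> 0" for d
    by (rule ws_nz[of _ "base G d"]) (simp add: gate_in_gates_at_iff)
  have towards: "towards \<omega> d \<longleftrightarrow> ?t d > 0" for d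
  proof (cases d)
    case (Pair e i)
    then show ?thesis
      using balanced[of e] t_nz[of "(e, True)"] by (cases i) (auto simp: towards_def \<omega>_def)
  qed
  define \<kappa> where "\<kappa> B = (SOME g. g \<in> B \<and> weighted_signs c g < 0)" for B
  have \<kappa>: "\<kappa> B \<in> B \<and> (\<forall>g\<in>B. \<kappa> B = g \<longleftrightarrow> weighted_signs c g < 0)" if B: "B \<in> infinitesimal_edges G u" for B u
  proof -
    obtain d d' where d: "B = {gate d, gate d'}" "gate d \<noteq> gate d'"
      using B unfolding infinitesimal_edges_eq by metis
    have sum: "?t d + ?t d' = 0"
      using alternating_pair[OF alternating_weighted_signs] B d by blast
    then have "?t d < 0 \<or> ?t d' < 0"
      using t_nz[of d] by linarith
    then have "\<exists>g. g \<in> B \<and> weighted_signs c g < 0"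
      using d by blast
    then have neg: "\<kappa> B \<in> B \<and> weighted_signs c (\<kappa> B) < 0"
      unfolding \<kappa>_def by (rule someI_ex)
    then consider "\<kappa> B = gate d" "?t d < 0" "\<not> ?t d' < 0" | "\<kappa> B = gate d'" "?t d' < 0" "\<not> ?t d < 0"
      using d(1) sum by force
    then show ?thesis
      using d by cases simp_all
  qed
  have "tau_orientation G \<omega> \<kappa>"
    unfolding tau_orientation_def
  proof (intro conjI allI ballI)
    show "\<kappa> B \<in> B" if "B \<in> infinitesimal_edges G u" for u B
      using \<kappa>[OF that] by blast
  next
    fix u g assume g: "g \<in> gates_at G u"
    have "towards \<omega> d \<longleftrightarrow> weighted_signs c g > 0" if "d \<in> g" for d
      using towards that mem_gates_at[OF g] by simp
    moreover have "\<kappa> B = g \<longleftrightarrow> weighted_signs c g < 0" if "B \<in> infinitesimal_edges G u" "g \<in> B" for B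
      using \<kappa> that by blast
    ultimately show "(\<forall>d\<in>g. towards \<omega> d) \<and> (\<forall>B\<in>infinitesimal_edges G u. g \<in> B \<longrightarrow> \<kappa> B \<noteq> g) \<or>
        (\<forall>d\<in>g. \<not> towards \<omega> d) \<and> (\<forall>B\<in>infinitesimal_edges G u. g \<in> B \<longrightarrow> \<kappa> B = g)"
      using ws_nz[OF g] by (cases "weighted_signs c g > 0") auto
  qed
  then show ?thesis
    unfolding tau_orientable_def by blast
qed

text \<open>
  Only vectors supported on the odd vertices, where the coordinate of \<open>\<delta>\<close> is zero, are orthogonal to the
  image.
\<close>

lemma dim_range_delta_nonorientable:
  assumes "\<not> tau_orientable G"
  shows "dim (range \<delta>) = card {v. non_odd_vertex S G v}"
proof -
  let ?N = "{v. non_odd_vertex S G v}"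
  let ?K = "{c. \<forall>y\<in>range \<delta>. real_inner_class.orthogonal y c}"
  have "?K = {c. \<forall>v. v \<notin> - ?N \<longrightarrow> vec_nth c v = 0}"
  proof (intro subset_antisym subsetI)
    fix c assume "c \<in> ?K"
    then have "\<forall>y\<in>range \<delta>. real_inner_class.orthogonal y (vec_lambda (vec_nth c))"
      by simp
    then have balanced: "weighted_signs (vec_nth c) (gate (e, True)) +
        weighted_signs (vec_nth c) (gate (e, False)) = 0" for e
      unfolding orthogonal_range_delta_iff by blast
    have "vec_nth c v = 0" if "non_odd_vertex S G v" for v
      using balanced_weights_imp_orientable[OF balanced that] assms by metis
    then show "c \<in> {c. \<forall>v. v \<notin> - ?N \<longrightarrow> vec_nth c v = 0}"
      by simp
  next
    fix c :: "real^'v" assume "c \<in> {c. \<forall>v. v \<notin> - ?N \<longrightarrow> vec_nth c v = 0}"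
    then have "weighted_signs (vec_nth c) (gate d) = 0" for d
      using weighted_signs_gate[of "gate d" "base G d" "vec_nth c"] by (simp add: gate_in_gates_at_iff)
    then show "c \<in> ?K"
      using orthogonal_range_delta_iff[of "vec_nth c"] by simp
  qed
  then have "dim ?K = card (- ?N)"
    using dim_substandard_cart[of "- ?N", where 'a = real] by (simp add: dim_vec_eq)
  moreover have "card ?N + card (- ?N) = CARD('v)"
    by (metis Compl_eq_Diff_UNIV card_Diff_subset card_mono finite le_add_diff_inverse subset_UNIV)
  ultimately show ?thesis
    using dim_range_delta by simp
qed

end

lemma linear_fstar: "linear (fstar G)"
proof -
  have "fstar G = (*v) (transition_matrix G)"
    by (rule ext) (simp add: fstar_def)
  then show ?thesis
    by simp
qed

section \<open>The decomposition of the space of weights\<close>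

theorem theorem2p14:
  fixes X :: "'s topology" and P :: "'s set"
    and A :: "('s set \<times> ('s \<Rightarrow> complex)) set" and F :: "'s \<Rightarrow> 's"
    and G :: "('s, 'v::finite, 'e::finite) graph_map"
    and s :: "'e gate \<Rightarrow> real"
  assumes "closed_surface X" and "finite P" and "P \<noteq> {}" and "P \<subseteq> topspace X"
    and "oriented_smooth_atlas (punctured X P) A"
    and "admits_hyperbolic_structure (punctured X P) A"
    and "diffeomorphism (punctured X P) A F"
    and "pseudo_Anosov X P F"
    and "bestvina_handel_train_track (punctured X P) F G"
    and "gate_signs (punctured X P) G s"
  shows
    "let f = fstar G; W = W_graph G; \<delta> = delta (punctured X P) G s;
         f_im = induced_on_image \<delta> f;
         h = char_poly_on W f;
         m = card {v. non_odd_vertex (punctured X P) G v}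
     in subspace W \<and> f ` W \<subseteq> W \<and> {\<eta>. \<delta> \<eta> = 0} = W \<and> (\<forall>\<eta>. f_im (\<delta> \<eta>) = \<delta> (f \<eta>)) \<and>
        (\<exists>\<Phi> :: real^'e \<Rightarrow> (real^'e) \<times> (real^'v).
           linear \<Phi> \<and> bij_betw \<Phi> UNIV (W \<times> range \<delta>)) \<and>
        char_poly_on UNIV f = h * char_poly_on (range \<delta>) f_im \<and>
        degree h = dim W \<and>
        (if tau_orientable G
         then int (dim W) = int CARD('e) - int CARD('v) + 1
         else int (dim W) = int CARD('e) - int m) \<and>
        degree (char_poly_on (range \<delta>) f_im) = dim (range \<delta>) \<and>
        (if tau_orientable G
         then int (dim (range \<delta>)) = int m - 1
         else dim (range \<delta>) = m)"
proof -
  let ?S = "punctured X P" and ?f = "fstar G" and ?W = "W_graph G"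
  let ?\<delta> = "delta ?S G s"
  let ?f_im = "induced_on_image ?\<delta> ?f" and ?m = "card {v. non_odd_vertex ?S G v}"
  have bh: "embedded_graph ?S G" "inclusion_homotopy_equivalence ?S G" "train_track_map G"
    "odd_vertex ?S G v \<or> even_vertex ?S G v \<or> partial_vertex ?S G v" for v
    using assms(9) unfolding bestvina_handel_train_track_def by blast+
  have Hausdorff: "Hausdorff_space ?S"
    using assms(1) unfolding closed_surface_def punctured_def by (auto intro: Hausdorff_space_subtopology)
  have conn: "connected_space (graph_space ?S G)"
    using bh(2) hyperbolic_imp_connected_space[OF assms(6)] by (rule connected_graph_space)
  interpret signed_train_track G ?S s
  proof
    show "c u = c v" if "\<And>e. c (base G (e, True)) = c (base G (e, False))" for c :: "'v \<Rightarrow> real" and u v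
      using bh(1) Hausdorff conn that by (rule edge_invariant_function_constant)
  qed (use bh assms(10) in auto)
  \<comment> \<open>the value does not depend on the chosen preimage, since two preimages differ by an element of the invariant kernel\<close>
  have f_im: "?f_im (?\<delta> \<eta>) = ?\<delta> (?f \<eta>)" for \<eta>
  proof -
    define \<zeta> where "\<zeta> = (SOME \<zeta>. ?\<delta> \<zeta> = ?\<delta> \<eta>)"
    have "?\<delta> \<zeta> = ?\<delta> \<eta>"
      unfolding \<zeta>_def by (rule someI[of _ \<eta>]) (rule refl)
    then have "\<zeta> - \<eta> \<in> ?W"
      unfolding kernel_delta[symmetric] by (simp add: linear_diff[OF linear_delta])
    then have "?f (\<zeta> - \<eta>) \<in> ?W"
      by (rule fstar_W_graph)
    then have "?\<delta> (?f \<zeta>) = ?\<delta> (?f \<eta>)"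
      unfolding kernel_delta[symmetric]
      by (simp add: linear_diff[OF linear_delta] linear_diff[OF linear_fstar])
    then show ?thesis
      by (simp add: induced_on_image_def \<zeta>_def)
  qed
  have im: "subspace (range ?\<delta>)"
    by (rule linear_subspace_image[OF linear_delta subspace_UNIV])
  have W: "subspace ?W"
    unfolding kernel_delta[symmetric] by (rule linear_subspace_kernel[OF linear_delta])
  have char_poly: "char_poly_on UNIV ?f = char_poly_on ?W ?f * char_poly_on (range ?\<delta>) ?f_im"
  proof -
    obtain r where r: "linear r" "\<And>y. y \<in> range ?\<delta> \<Longrightarrow> ?\<delta> (r y) = y"
      using linear_exists_right_inverse_on[OF linear_delta subspace_UNIV] by auto
    \<comment> \<open>the induced map need not be linear off the image, where its value is arbitrary; this is a linear map that agrees with it on the image\<close>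
    define g where "g = ?\<delta> \<circ> ?f \<circ> r"
    have g: "g (?\<delta> \<eta>) = ?\<delta> (?f \<eta>)" for \<eta>
      using f_im[of "r (?\<delta> \<eta>)"] f_im[of \<eta>] r(2)[of "?\<delta> \<eta>"] by (simp add: g_def)
    have "linear g"
      unfolding g_def by (intro linear_compose linear_delta linear_fstar r)
    then have "char_poly_on UNIV ?f = char_poly_on ?W ?f * char_poly_on (range ?\<delta>) g"
      using char_poly_on_kernel_times_image[OF linear_fstar linear_delta _ g] by (simp add: kernel_delta)
    also have "char_poly_on (range ?\<delta>) g = char_poly_on (range ?\<delta>) ?f_im"
      by (rule char_poly_on_cong[OF im]) (auto simp: g f_im)
    finally show ?thesis .
  qed
  obtain \<Phi> :: "real^'e \<Rightarrow> (real^'e) \<times> (real^'v)"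
    where \<Phi>: "linear \<Phi>" "bij_betw \<Phi> UNIV (?W \<times> range ?\<delta>)"
    using kernel_image_decomposition[OF linear_delta] unfolding kernel_delta by blast
  have dims: "dim ?W + dim (range ?\<delta>) = CARD('e)"
    using dim_kernel_plus_dim_image[OF linear_delta] by (simp add: kernel_delta)
  have dim_im: "if tau_orientable G then dim (range ?\<delta>) + 1 = CARD('v) \<and> ?m = CARD('v)
      else dim (range ?\<delta>) = ?m"
    using dim_range_delta_orientable dim_range_delta_nonorientable orientable_imp_non_odd by simp
  show ?thesis
    unfolding Let_def
    using W fstar_W_graph kernel_delta f_im \<Phi> char_poly degree_char_poly_on[OF W]
      degree_char_poly_on[OF im] dims dim_im
    by (intro conjI) (auto split: if_splits)
qed

end
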